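(* For every integer $n\ge0$, $$Q_{T_n}(t)=\sum_{k=0}^{\lfloor n/2\rfloor}\Big(\sum_{i=0}^{k}\ \sum_{j=k-i}^{\lfloor (n-3i)/2\rfloor}\frac{(j+1)(n-3i-j+2)(n-3i-2j+1)^2\,n!}{i!\,(i+j+1)!\,(n-2i-j+2)!}\Big)t^k .$$
   Context: $T_n$ is the graphic matroid of $K_{1,1,n}$ (vertices $A,B,1,\dots,n$, edges $AB,Aj,Bj$ for $1\le j\le n$). For a loopless matroid $\mathrm M$ (lattice of flats $\mathcal L(\mathrm M)$, characteristic polynomial $\chi$, restriction $\mathrm M|_F$, contraction $\mathrm M/F$), the inverse Kazhdan--Lusztig polynomial $Q_{\mathrm M}(t)\in\mathbb Z[t]$ is the unique polynomial with $Q_{\mathrm M}=1$ if $\operatorname{rk}\mathrm M=0$, $\deg Q_{\mathrm M}<\tfrac12\operatorname{rk}\mathrm M$ if $\operatorname{rk}\mathrm M>0$, and $t^{\operatorname{rk}\mathrm M}(-1)^{\operatorname{rk}\mathrm M}Q_{\mathrm M}(t^{-1})=\sum_{F\in\mathcal L(\mathrm M)}(-1)^{\operatorname{rk}\mathrm M|_F}Q_{\mathrm M|_F}(t)\,t^{\operatorname{rk}\mathrm M/F}\chi_{\mathrm M/F}(t^{-1})$. *)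

theory Defs
  imports Complex_Main "HOL-Computational_Algebra.Polynomial"
begin

section \<open>Matroids\<close>

record 'a matroid =
  ground :: "'a set"
  indep :: "'a set \<Rightarrow> bool"

definition matroid :: "'a matroid \<Rightarrow> bool" where
  "matroid M \<longleftrightarrow>
     finite (ground M) \<and>
     (\<forall>I. indep M I \<longrightarrow> I \<subseteq> ground M) \<and>
     indep M {} \<and>
     (\<forall>I J. indep M J \<longrightarrow> I \<subseteq> J \<longrightarrow> indep M I) \<and>
     (\<forall>I J. indep M I \<longrightarrow> indep M J \<longrightarrow> card I < card J \<longrightarrow> (\<exists>x\<in>J - I. indep M (insert x I)))"

definition loopless :: "'a matroid \<Rightarrow> bool" where
  "loopless M \<longleftrightarrow> (\<forall>e\<in>ground M. indep M {e})"

definition rk :: "'a matroid \<Rightarrow> 'a set \<Rightarrow> nat" where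
  "rk M X = Max (card ` {I. I \<subseteq> X \<and> indep M I})"

abbreviation rank :: "'a matroid \<Rightarrow> nat" where
  "rank M \<equiv> rk M (ground M)"

definition flats :: "'a matroid \<Rightarrow> 'a set set" where
  "flats M = {F. F \<subseteq> ground M \<and> (\<forall>e\<in>ground M - F. rk M F < rk M (insert e F))}"

definition basis_of :: "'a matroid \<Rightarrow> 'a set \<Rightarrow> 'a set \<Rightarrow> bool" where
  "basis_of M X B \<longleftrightarrow> B \<subseteq> X \<and> indep M B \<and> (\<forall>x\<in>X - B. \<not> indep M (insert x B))"

definition restriction :: "'a matroid \<Rightarrow> 'a set \<Rightarrow> 'a matroid" where
  "restriction M F = \<lparr>ground = F, indep = (\<lambda>I. I \<subseteq> F \<and> indep M I)\<rparr>"

definition contraction :: "'a matroid \<Rightarrow> 'a set \<Rightarrow> 'a matroid" where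
  "contraction M F =
     \<lparr>ground = ground M - F,
      indep = (\<lambda>I. I \<subseteq> ground M - F \<and> (\<exists>B. basis_of M F B \<and> indep M (I \<union> B)))\<rparr>"

text \<open>The Moebius function of a family \<open>L\<close> of finite sets ordered by inclusion.\<close>

function mobius :: "'a set set \<Rightarrow> 'a set \<Rightarrow> 'a set \<Rightarrow> int" where
  "mobius L X Y =
     (if \<not> finite Y \<or> \<not> X \<subseteq> Y then 0
      else if X = Y then 1
      else - (\<Sum>Z\<in>{Z \<in> L. X \<subseteq> Z \<and> Z \<subset> Y}. mobius L X Z))"
  by pat_completeness auto
termination
  by (relation "measure (\<lambda>(L, X, Y). card Y)") (auto intro: psubset_card_mono)

declare mobius.simps [simp del]

text \<open>The least element of the lattice of flats is \<open>\<Inter>(flats M)\<close>.\<close>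

definition characteristic_poly :: "'a matroid \<Rightarrow> int poly" where
  "characteristic_poly M =
     (\<Sum>F\<in>flats M. monom (mobius (flats M) (\<Inter>(flats M)) F) (rank M - rk M F))"


section \<open>Inverse Kazhdan--Lusztig polynomials\<close>

text \<open>For \<open>degree p \<le> r\<close>, the polynomial \<open>rev_at r p\<close> is $t^r p(t^{-1})$;
  see \<open>poly_rev_at\<close> below.\<close>

definition rev_at :: "nat \<Rightarrow> int poly \<Rightarrow> int poly" where
  "rev_at r p = (\<Sum>i\<le>r. monom (coeff p i) (r - i))"

lemma coeff_rev_at: "coeff (rev_at r p) i = (if i \<le> r then coeff p (r - i) else 0)"
proof -
  have "coeff (rev_at r p) i = (\<Sum>j\<le>r. if j = r - i \<and> i \<le> r then coeff p j else 0)"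
    unfolding rev_at_def coeff_sum coeff_monom by (intro sum.cong) auto
  then show ?thesis by (auto simp: sum.delta)
qed

lemma poly_eq_sum_le:
  fixes x :: "'a::comm_ring_1"
  assumes "degree p \<le> r"
  shows "poly p x = (\<Sum>i\<le>r. coeff p i * x ^ i)"
  unfolding poly_altdef using assms by (intro sum.mono_neutral_left) (auto simp: coeff_eq_0)

lemma poly_rev_at:
  fixes x :: rat
  assumes "degree p \<le> r" "x \<noteq> 0"
  shows "poly (map_poly of_int (rev_at r p)) x = x ^ r * poly (map_poly of_int p) (1 / x)"
proof -
  let ?c = "\<lambda>i. of_int (coeff p i) :: rat"
  have d: "degree (map_poly of_int (rev_at r p) :: rat poly) \<le> r"
    by (rule degree_le) (auto simp: coeff_map_poly coeff_rev_at)
  have e: "degree (map_poly of_int p :: rat poly) \<le> r"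
    using assms(1) by (intro degree_le) (auto simp: coeff_map_poly coeff_eq_0)
  have "poly (map_poly of_int (rev_at r p)) x = (\<Sum>i\<le>r. ?c (r - i) * x ^ i)"
    by (subst poly_eq_sum_le[OF d]) (auto simp: coeff_map_poly coeff_rev_at)
  also have "\<dots> = (\<Sum>i\<le>r. ?c i * x ^ (r - i))"
    by (rule sum.reindex_bij_witness[of _ "\<lambda>i. r - i" "\<lambda>i. r - i"]) auto
  also have "\<dots> = x ^ r * (\<Sum>i\<le>r. ?c i * (1 / x) ^ i)"
    using assms(2) by (auto simp: sum_distrib_left power_diff power_one_over field_simps intro!: sum.cong)
  also have "(\<Sum>i\<le>r. ?c i * (1 / x) ^ i) = poly (map_poly of_int p) (1 / x)"
    by (subst poly_eq_sum_le[OF e]) (auto simp: coeff_map_poly)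
  finally show ?thesis .
qed

text \<open>The defining identity expresses $Q_M$ in terms of $Q_{M|F}$ for the flats $F$ of $M$.
  The flat \<open>ground M\<close> contributes $Q_M$ itself, the unknown \<open>q\<close>; all others have smaller ground
  sets. That this recursion determines the same polynomials as the system of
  conditions on the whole family is \<open>inverse_KL_unique\<close> below.\<close>

function inverse_KL :: "'a matroid \<Rightarrow> int poly" where
  "inverse_KL M =
     (if infinite (ground M) then undefined
      else if rank M = 0 then 1
      else (THE q. 2 * degree q < rank M \<and>
              smult ((-1) ^ rank M) (rev_at (rank M) q) =
              (\<Sum>F\<in>flats M.
                 smult ((-1) ^ rank (restriction M F))
                   (if F = ground M then q else inverse_KL (restriction M F)) *
                 rev_at (rank (contraction M F)) (characteristic_poly (contraction M F)))))"
  by pat_completeness auto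
termination
  by (relation "measure (\<lambda>M. card (ground M))")
     (auto simp: flats_def restriction_def intro!: psubset_card_mono)

declare inverse_KL.simps [simp del]

definition inverse_KL_family :: "('a matroid \<Rightarrow> int poly) \<Rightarrow> bool" where
  "inverse_KL_family Q \<longleftrightarrow> (\<forall>M. matroid M \<longrightarrow> loopless M \<longrightarrow>
     (rank M = 0 \<longrightarrow> Q M = 1) \<and>
     (rank M > 0 \<longrightarrow> 2 * degree (Q M) < rank M) \<and>
     smult ((-1) ^ rank M) (rev_at (rank M) (Q M)) =
       (\<Sum>F\<in>flats M. smult ((-1) ^ rank (restriction M F)) (Q (restriction M F)) *
          rev_at (rank (contraction M F)) (characteristic_poly (contraction M F))))"

lemma matroidD:
  assumes "matroid M"
  shows "finite (ground M)" "indep M {}"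
    and "indep M I \<Longrightarrow> I \<subseteq> ground M"
    and "indep M J \<Longrightarrow> I \<subseteq> J \<Longrightarrow> indep M I"
    and "indep M I \<Longrightarrow> indep M J \<Longrightarrow> card I < card J \<Longrightarrow> \<exists>x\<in>J - I. indep M (insert x I)"
  using assms by (simp_all add: matroid_def)

lemma matroid_restriction:
  assumes M: "matroid M" and F: "F \<subseteq> ground M"
  shows "matroid (restriction M F)"
proof -
  have fin: "finite F" using F matroidD(1)[OF M] by (rule finite_subset)
  have aug: "\<exists>x\<in>J - I. insert x I \<subseteq> F \<and> indep M (insert x I)"
    if "I \<subseteq> F" "indep M I" "J \<subseteq> F" "indep M J" "card I < card J" for I J
    using matroidD(5)[OF M that(2,4,5)] that(1,3) by blast
  show ?thesis
    unfolding matroid_def restriction_def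
    using fin aug matroidD(2)[OF M] matroidD(4)[OF M] by simp (meson subset_trans)
qed

lemma loopless_restriction:
  "loopless M \<Longrightarrow> F \<subseteq> ground M \<Longrightarrow> loopless (restriction M F)"
  unfolding loopless_def restriction_def by auto

lemma restriction_ground:
  assumes "matroid M"
  shows "restriction M (ground M) = M"
proof -
  have "(\<lambda>I. I \<subseteq> ground M \<and> indep M I) = indep M"
    using matroidD(3)[OF assms] by blast
  then show ?thesis unfolding restriction_def by simp
qed

lemma ex_basis_of:
  assumes "matroid M"
  shows "\<exists>B. basis_of M (ground M) B"
proof -
  let ?I = "{I. indep M I}"
  have "?I \<subseteq> Pow (ground M)" using matroidD(3)[OF assms] by blast
  then have fin: "finite ?I" using matroidD(1)[OF assms] by (simp add: finite_subset)
  have "?I \<noteq> {}" using matroidD(2)[OF assms] by blast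
  then obtain B where B: "B \<in> ?I" "\<And>C. C \<in> ?I \<Longrightarrow> B \<subseteq> C \<Longrightarrow> B = C"
    using finite_has_maximal[OF fin] by blast
  have "\<not> indep M (insert x B)" if "x \<in> ground M - B" for x
    using B(2)[of "insert x B"] that by blast
  then have "basis_of M (ground M) B"
    using B(1) matroidD(3)[OF assms] by (simp add: basis_of_def)
  then show ?thesis ..
qed

lemma contraction_ground:
  assumes "matroid M"
  shows "rank (contraction M (ground M)) = 0" "characteristic_poly (contraction M (ground M)) = 1"
proof -
  let ?N = "contraction M (ground M)"
  obtain B where "basis_of M (ground M) B" using ex_basis_of[OF assms] by blast
  then have i: "indep ?N {}" unfolding contraction_def basis_of_def by auto
  have g: "ground ?N = {}" unfolding contraction_def by simp
  have "{I. I \<subseteq> {} \<and> indep ?N I} = {{}}" using i by blast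
  then have r: "rk ?N {} = 0" unfolding rk_def by simp
  show "rank ?N = 0" using r g by simp
  have "flats ?N = {{}}" unfolding flats_def g by auto
  then show "characteristic_poly ?N = 1"
    unfolding characteristic_poly_def g by (simp add: r mobius.simps)
qed

lemma ground_in_flats: "ground M \<in> flats M"
  unfolding flats_def by auto

lemma finite_flats: "finite (ground M) \<Longrightarrow> finite (flats M)"
  unfolding flats_def by auto

lemma rev_at_fixed_eq_0:
  assumes "2 * degree d < r" "rev_at r d = d"
  shows "d = 0"
proof (rule poly_eqI)
  fix i
  show "coeff d i = coeff 0 i"
  proof (cases "2 * i < r")
    case True
    then have "coeff d i = coeff d (r - i)"
      using assms(2) coeff_rev_at[of r d i] by simp
    also have "\<dots> = 0" using True assms(1) by (intro coeff_eq_0) linarith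
    finally show ?thesis by simp
  next
    case False
    then show ?thesis using assms(1) by (simp add: coeff_eq_0)
  qed
qed

lemma smult_left_cancel:
  fixes c :: int
  shows "c \<noteq> 0 \<Longrightarrow> smult c p = smult c q \<Longrightarrow> p = q"
  by (simp add: poly_eq_iff)

lemma rev_at_diff: "rev_at r (p - q) = rev_at r p - rev_at r q"
  by (rule poly_eqI) (auto simp: coeff_rev_at)

theorem inverse_KL_unique:
  assumes Q: "inverse_KL_family Q" and "matroid M" "loopless M"
  shows "inverse_KL M = Q M"
  using assms(2,3)
proof (induction "card (ground M)" arbitrary: M rule: less_induct)
  case less
  let ?r = "rank M"
  let ?s = "(-1) ^ ?r :: int"
  let ?c = "\<lambda>F. rev_at (rank (contraction M F)) (characteristic_poly (contraction M F))"
  let ?t = "\<lambda>F. smult ((-1) ^ rank (restriction M F)) (Q (restriction M F)) * ?c F"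
  have fin: "finite (ground M)" by (rule matroidD(1)[OF less.prems(1)])
  have Q0: "?r = 0 \<Longrightarrow> Q M = 1" and Q1: "?r > 0 \<Longrightarrow> 2 * degree (Q M) < ?r"
    and Q2: "smult ?s (rev_at ?r (Q M)) = (\<Sum>F\<in>flats M. ?t F)"
    using Q less.prems by (simp_all add: inverse_KL_family_def)
  have IH: "inverse_KL (restriction M F) = Q (restriction M F)"
    if "F \<in> flats M" "F \<noteq> ground M" for F
  proof (rule less.hyps)
    have F: "F \<subset> ground M" using that unfolding flats_def by blast
    then show "card (ground (restriction M F)) < card (ground M)"
      using fin psubset_card_mono unfolding restriction_def by simp
    show "matroid (restriction M F)" "loopless (restriction M F)"
      using F less.prems matroid_restriction loopless_restriction by blast+
  qed
  have c1: "?c (ground M) = 1"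
    unfolding contraction_ground[OF less.prems(1)] by (simp add: rev_at_def)
  have split: "(\<Sum>F\<in>flats M. smult ((-1) ^ rank (restriction M F))
                   (if F = ground M then q else inverse_KL (restriction M F)) * ?c F)
      = smult ?s q + (\<Sum>F\<in>flats M - {ground M}. ?t F)" for q
  proof -
    have "(\<Sum>F\<in>flats M - {ground M}. smult ((-1) ^ rank (restriction M F))
             (if F = ground M then q else inverse_KL (restriction M F)) * ?c F)
        = (\<Sum>F\<in>flats M - {ground M}. ?t F)"
      by (intro sum.cong) (auto simp: IH)
    then show ?thesis
      by (subst sum.remove[OF finite_flats[OF fin] ground_in_flats])
         (simp add: c1 restriction_ground[OF less.prems(1)])
  qed
  have Q3: "smult ?s (rev_at ?r (Q M)) = smult ?s (Q M) + (\<Sum>F\<in>flats M - {ground M}. ?t F)"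
    unfolding Q2
    by (subst sum.remove[OF finite_flats[OF fin] ground_in_flats])
       (simp add: c1 restriction_ground[OF less.prems(1)])
  show ?case
  proof (cases "?r = 0")
    case True
    then show ?thesis using fin Q0 by (simp add: inverse_KL.simps[of M])
  next
    case False
    have "inverse_KL M = (THE q. 2 * degree q < ?r \<and>
        smult ?s (rev_at ?r q) = smult ?s q + (\<Sum>F\<in>flats M - {ground M}. ?t F))"
      using False fin by (subst inverse_KL.simps) (simp only: split if_False simp_thms)
    also have "\<dots> = Q M"
    proof (rule the_equality)
      show "2 * degree (Q M) < ?r \<and>
          smult ?s (rev_at ?r (Q M)) = smult ?s (Q M) + (\<Sum>F\<in>flats M - {ground M}. ?t F)"
        using Q1 Q3 False by blast
    next
      fix q
      assume q: "2 * degree q < ?r \<and>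
          smult ?s (rev_at ?r q) = smult ?s q + (\<Sum>F\<in>flats M - {ground M}. ?t F)"
      have "smult ?s (rev_at ?r q) - smult ?s (rev_at ?r (Q M)) = smult ?s q - smult ?s (Q M)"
        using q Q3 by simp
      then have "smult ?s (rev_at ?r (q - Q M)) = smult ?s (q - Q M)"
        by (simp add: rev_at_diff smult_diff_right)
      then have "rev_at ?r (q - Q M) = q - Q M"
        by (rule smult_left_cancel[rotated]) simp
      moreover have "2 * degree (q - Q M) < ?r"
        using q Q1 False degree_diff_le_max[of q "Q M"] by linarith
      ultimately have "q - Q M = 0" by (rule rev_at_fixed_eq_0[rotated])
      then show "q = Q M" by simp
    qed
    finally show ?thesis .
  qed
qed


section \<open>The graphic matroid of \<open>K\<^bsub>1,1,n\<^esub>\<close>\<close>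

text \<open>A simple graph is given by its set of edges, each a two-element set of vertices.\<close>

definition is_cycle :: "'v set set \<Rightarrow> 'v list \<Rightarrow> bool" where
  "is_cycle X p \<longleftrightarrow> length p \<ge> 3 \<and> distinct p \<and>
     (\<forall>i<length p. {p ! i, p ! (Suc i mod length p)} \<in> X)"

definition graphic_matroid :: "'v set set \<Rightarrow> 'v set matroid" where
  "graphic_matroid E = \<lparr>ground = E, indep = (\<lambda>X. X \<subseteq> E \<and> (\<nexists>p. is_cycle X p))\<rparr>"

datatype vertex = VA | VB | VN nat

definition K11_edges :: "nat \<Rightarrow> vertex set set" where
  "K11_edges n = {{VA, VB}} \<union> {{VA, VN j} |j. 1 \<le> j \<and> j \<le> n} \<union> {{VB, VN j} |j. 1 \<le> j \<and> j \<le> n}"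

definition thagomizer :: "nat \<Rightarrow> vertex set matroid" where
  "thagomizer n = graphic_matroid (K11_edges n)"

end

theory Submission
  imports Defs
begin

text \<open>
  A flat of \<open>T\<^sub>n\<close> either contains the edge \<open>AB\<close>, and is then \<open>T\<^sub>U\<close> for a subset \<open>U\<close> of the vertices
  \<open>1, \<dots>, n\<close>, with a Boolean interval above it, or it picks at most one of the two edges at each vertex \<open>j\<close>, and is then
  Boolean, with contraction \<open>T\<^bsub>n-|F|\<^esub>\<close> up to parallel edges. Boolean matroids have \<open>Q = 1\<close>, so the
  defining identity becomes
  \<open>t\<^bsup>n+1\<^esup> Q\<^sub>n(1/t) = (\<Sum>s. (n choose s) (t-1)\<^bsup>n-s\<^esup> Q\<^sub>s(t)) + (t-1) (1+2t)\<^bsup>n\<^esup>\<close>.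
  Writing \<open>Q\<^sub>n = (\<Sum>s. (n choose s) R\<^sub>s)\<close> turns it into \<open>t\<^bsup>s+1\<^esup> R\<^sub>s(1/t) = R\<^sub>s(t) + (t-1) (1+t)\<^bsup>s\<^esup>\<close>,
  so by the degree bound \<open>R\<^sub>s\<close> is the lower half of \<open>(1-t) (1+t)\<^bsup>s\<^esup>\<close>, whose coefficients
  \<open>(s choose k) - (s choose (k-1))\<close> are dimensions of two-row Specht modules.
  The stated formula is Pieri's rule for inducing their products with trivial modules: the summand
  for \<open>(i, j)\<close> is \<open>\<lambda>\<^sub>1 - \<lambda>\<^sub>2 + 1\<close> times the dimension of the Specht module of shape
  \<open>\<lambda> = (n-2i-j, i+j, i)\<close>. It is proved by induction on \<open>n\<close> with the branching rule.
\<close>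

section \<open>Flats and characteristic polynomials of contractions\<close>

lemma finite_indep_subsets:
  assumes "matroid M"
  shows "finite {I. I \<subseteq> X \<and> indep M I}"
  using matroidD(1,3)[OF assms] by (auto intro: finite_subset[of _ "Pow (ground M)"])

lemma card_le_rk:
  assumes "matroid M" "I \<subseteq> X" "indep M I"
  shows "card I \<le> rk M X"
  unfolding rk_def using finite_indep_subsets[OF assms(1), of X] assms(2,3) by (intro Max_ge) auto

lemma ex_indep_card_rk:
  assumes "matroid M"
  obtains I where "I \<subseteq> X" "indep M I" "card I = rk M X"
proof -
  have "rk M X \<in> card ` {I. I \<subseteq> X \<and> indep M I}"
    unfolding rk_def using finite_indep_subsets[OF assms, of X] matroidD(2)[OF assms]
    by (intro Max_in) auto
  then show ?thesis using that by auto
qed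

lemma rk_mono:
  assumes "matroid M" "X \<subseteq> Y"
  shows "rk M X \<le> rk M Y"
proof -
  obtain I where "I \<subseteq> X" "indep M I" "card I = rk M X" using ex_indep_card_rk[OF assms(1)] .
  then show ?thesis using card_le_rk[OF assms(1), of I Y] assms(2) by auto
qed

lemma finite_indep: "matroid M \<Longrightarrow> indep M I \<Longrightarrow> finite I"
  using matroidD(1,3) finite_subset by metis

lemma card_basis_of:
  assumes M: "matroid M" and B: "basis_of M X B"
  shows "card B = rk M X"
proof (rule antisym)
  show "card B \<le> rk M X" using B card_le_rk[OF M] unfolding basis_of_def by blast
  obtain I where I: "I \<subseteq> X" "indep M I" "card I = rk M X" using ex_indep_card_rk[OF M] .
  show "rk M X \<le> card B"
  proof (rule ccontr)
    assume "\<not> rk M X \<le> card B"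
    then have "card B < card I" using I(3) by simp
    then obtain x where "x \<in> I - B" "indep M (insert x B)"
      using matroidD(5)[OF M _ I(2)] B unfolding basis_of_def by blast
    then show False using B I(1) unfolding basis_of_def by blast
  qed
qed

lemma ex_basis_of_extending:
  assumes M: "matroid M" and I: "I \<subseteq> X" "indep M I"
  obtains B where "basis_of M X B" "I \<subseteq> B"
proof -
  let ?A = "{J. J \<subseteq> X \<and> indep M J \<and> I \<subseteq> J}"
  have fin: "finite ?A"
    by (rule finite_subset[OF _ finite_indep_subsets[OF M, of X]]) blast
  have ne: "?A \<noteq> {}" using I by blast
  obtain B where B: "B \<in> ?A" "\<forall>C\<in>?A. B \<subseteq> C \<longrightarrow> B = C"
    by (rule bexE[OF finite_has_maximal[OF fin ne]])
  have "\<not> indep M (insert x B)" if "x \<in> X - B" for x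
    using B(1) B(2)[rule_format, of "insert x B"] that by blast
  then have "basis_of M X B" using B(1) unfolding basis_of_def by auto
  then show ?thesis using that B(1) by auto
qed

section \<open>Contractions: rank, flats, reversed characteristic polynomial\<close>

lemma ground_contraction: "ground (contraction M F) = ground M - F"
  by (simp add: contraction_def)

text \<open>Independence in the contraction is witnessed by some basis of \<open>F\<close>, and all
  bases of \<open>F\<close> have size \<open>rk M F\<close>; this gives the upper bound. Extending
  one basis of \<open>F\<close> to a basis of \<open>X \<union> F\<close> attains it.\<close>

lemma rk_contraction:
  assumes M: "matroid M" and X: "X \<subseteq> ground M - F"
  shows "rk (contraction M F) X = rk M (X \<union> F) - rk M F"
proof -
  have le: "card I \<le> rk M (X \<union> F) - rk M F" if "I \<subseteq> X" "indep (contraction M F) I" for I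
  proof -
    have "\<exists>B. basis_of M F B \<and> indep M (I \<union> B)" and IF: "I \<inter> F = {}"
      using that(2) unfolding contraction_def by auto
    then obtain B where B: "basis_of M F B" "indep M (I \<union> B)" by blast
    have "card (I \<union> B) = card I + card B"
      using B IF finite_indep[OF M B(2)] unfolding basis_of_def by (intro card_Un_disjoint) auto
    moreover have "card (I \<union> B) \<le> rk M (X \<union> F)"
      using B that(1) unfolding basis_of_def by (intro card_le_rk[OF M]) auto
    ultimately show ?thesis using card_basis_of[OF M B(1)] by simp
  qed
  obtain B where B: "basis_of M F B"
    using ex_basis_of_extending[OF M, of "{}" F] matroidD(2)[OF M] by auto
  then obtain B' where B': "basis_of M (X \<union> F) B'" "B \<subseteq> B'"
    using ex_basis_of_extending[OF M, of B "X \<union> F"] unfolding basis_of_def by auto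
  have iB': "indep M B'" using B' unfolding basis_of_def by auto
  \<comment> \<open>Maximality of \<open>B\<close> in \<open>F\<close> keeps the added elements out
    of \<open>F\<close>.\<close>
  have "B' \<inter> F \<subseteq> B"
  proof
    fix x assume x: "x \<in> B' \<inter> F"
    have "indep M (insert x B)" using matroidD(4)[OF M iB', of "insert x B"] x B'(2) by auto
    then show "x \<in> B" using B x unfolding basis_of_def by auto
  qed
  then have sub: "B' - B \<subseteq> X" using B' unfolding basis_of_def by auto
  moreover have "(B' - B) \<union> B = B'" using B'(2) by auto
  ultimately have ind: "indep (contraction M F) (B' - B)"
    using B iB' X unfolding contraction_def by auto
  have card: "card (B' - B) = rk M (X \<union> F) - rk M F"
    using card_basis_of[OF M B] card_basis_of[OF M B'(1)] B'(2) finite_indep[OF M iB']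
    by (simp add: card_Diff_subset finite_subset)
  have "finite X" using X matroidD(1)[OF M] by (auto intro: finite_subset)
  then have "finite {I. I \<subseteq> X \<and> indep (contraction M F) I}" by simp
  then show ?thesis
    unfolding rk_def[of "contraction M F"] using le sub ind card[symmetric] by (intro Max_eqI) auto
qed

lemma flats_contraction:
  assumes M: "matroid M" and F: "F \<subseteq> ground M"
  shows "flats (contraction M F) = (\<lambda>G. G - F) ` {G \<in> flats M. F \<subseteq> G}"
proof -
  have iff: "H \<in> flats (contraction M F) \<longleftrightarrow> H \<union> F \<in> flats M" if H: "H \<subseteq> ground M - F" for H
  proof -
    have "rk (contraction M F) H < rk (contraction M F) (insert e H)
        \<longleftrightarrow> rk M (H \<union> F) < rk M (insert e (H \<union> F))" if "e \<in> ground M - F - H" for e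
    proof -
      have "rk (contraction M F) H = rk M (H \<union> F) - rk M F"
        using H by (rule rk_contraction[OF M])
      moreover have "rk (contraction M F) (insert e H) = rk M (insert e (H \<union> F)) - rk M F"
        using rk_contraction[OF M, of "insert e H" F] that H by simp
      \<comment> \<open>Both ranks are at least \<open>rk M F\<close>, so the truncated subtractions
        preserve the strict inequality.\<close>
      moreover have "rk M F \<le> rk M (H \<union> F)" "rk M F \<le> rk M (insert e (H \<union> F))"
        by (auto intro: rk_mono[OF M])
      ultimately show ?thesis by linarith
    qed
    moreover have "ground M - F - H = ground M - (H \<union> F)" by auto
    ultimately show ?thesis using H F unfolding flats_def ground_contraction by auto
  qed
  show ?thesis
  proof (intro equalityI subsetI)
    fix H assume h: "H \<in> flats (contraction M F)"
    then have H: "H \<subseteq> ground M - F" unfolding flats_def ground_contraction by auto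
    then have "H = (H \<union> F) - F" by auto
    then show "H \<in> (\<lambda>G. G - F) ` {G \<in> flats M. F \<subseteq> G}" using iff[OF H] h by blast
  next
    fix H assume "H \<in> (\<lambda>G. G - F) ` {G \<in> flats M. F \<subseteq> G}"
    then obtain G where G: "G \<in> flats M" "F \<subseteq> G" "H = G - F" by auto
    then have "H \<subseteq> ground M - F" "H \<union> F = G" unfolding flats_def by auto
    then show "H \<in> flats (contraction M F)" using iff G by simp
  qed
qed

text \<open>Deleting \<open>F\<close> is an order isomorphism from the members of \<open>L\<close>
  above \<open>F\<close> onto the quotient family, and the Moebius recursion only looks at
  intervals.\<close>

lemma mobius_quotient:
  assumes "finite G" "F \<subseteq> G"
  shows "mobius ((\<lambda>G. G - F) ` {G \<in> L. F \<subseteq> G}) {} (G - F) = mobius L F G"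
  using assms
proof (induction "card G" arbitrary: G rule: less_induct)
  case less
  let ?L = "(\<lambda>G. G - F) ` {G \<in> L. F \<subseteq> G}"
  show ?case
  proof (cases "F = G")
    case True
    then show ?thesis using less.prems by (simp add: mobius.simps)
  next
    case False
    let ?A = "{Z \<in> L. F \<subseteq> Z \<and> Z \<subset> G}"
    have "{Z \<in> ?L. {} \<subseteq> Z \<and> Z \<subset> G - F} = (\<lambda>Z. Z - F) ` ?A"
      using less.prems by blast
    moreover have "inj_on (\<lambda>Z. Z - F) ?A" by (rule inj_onI) blast
    ultimately have "(\<Sum>Z\<in>{Z \<in> ?L. {} \<subseteq> Z \<and> Z \<subset> G - F}. mobius ?L {} Z)
        = (\<Sum>Z\<in>?A. mobius ?L {} (Z - F))" by (simp add: sum.reindex)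
    also have "\<dots> = (\<Sum>Z\<in>?A. mobius L F Z)"
      using less by (intro sum.cong refl less.hyps) (auto intro: psubset_card_mono finite_subset)
    finally show ?thesis
      using less.prems False by (subst (1 2) mobius.simps) auto
  qed
qed

text \<open>The vanishing sums over the intervals from \<open>X\<close> to \<open>Y\<close> are the
  Moebius recursion in closed form. Each Moebius value below is thus a guess confirmed by a binomial
  sum.\<close>

lemma mobius_eqI:
  assumes L: "finite L" "\<And>Y. Y \<in> L \<Longrightarrow> finite Y" and X: "X \<in> L" "m X = 1"
    and m: "\<And>Y. Y \<in> L \<Longrightarrow> X \<subset> Y \<Longrightarrow> (\<Sum>Z\<in>{Z \<in> L. X \<subseteq> Z \<and> Z \<subseteq> Y}. m Z) = 0"
    and Y: "Y \<in> L" "X \<subseteq> Y"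
  shows "mobius L X Y = m Y"
  using Y
proof (induction "card Y" arbitrary: Y rule: less_induct)
  case less
  show ?case
  proof (cases "X = Y")
    case True
    then show ?thesis using X L(2) by (simp add: mobius.simps)
  next
    case False
    let ?A = "{Z \<in> L. X \<subseteq> Z \<and> Z \<subset> Y}"
    have "{Z \<in> L. X \<subseteq> Z \<and> Z \<subseteq> Y} = insert Y ?A" using less.prems by auto
    then have "m Y + (\<Sum>Z\<in>?A. m Z) = 0"
      using m[OF less.prems(1)] less.prems False L(1) by (auto simp: psubset_eq)
    moreover have "(\<Sum>Z\<in>?A. mobius L X Z) = (\<Sum>Z\<in>?A. m Z)"
      using less L(2)[OF less.prems(1)] by (intro sum.cong refl less.hyps) (auto intro: psubset_card_mono)
    ultimately show ?thesis using less.prems False L(2) by (subst mobius.simps) auto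
  qed
qed

lemma rev_at_monom: "i \<le> r \<Longrightarrow> rev_at r (monom c i) = monom c (r - i)"
  by (rule poly_eqI) (auto simp: coeff_rev_at)

lemma rev_at_sum: "rev_at r (\<Sum>x\<in>A. f x) = (\<Sum>x\<in>A. rev_at r (f x))"
  by (rule poly_eqI) (simp add: coeff_rev_at coeff_sum)

text \<open>Coranks are the exponents of the characteristic polynomial; reversal turns them into
  ranks. With \<open>mobius_quotient\<close> the contraction disappears from the defining identity,
  leaving only data of \<open>M\<close>.\<close>

lemma rev_characteristic_poly_contraction:
  assumes M: "matroid M" and F: "F \<in> flats M"
  shows "rev_at (rank (contraction M F)) (characteristic_poly (contraction M F)) =
    (\<Sum>G\<in>{G \<in> flats M. F \<subseteq> G}. monom (mobius (flats M) F G) (rk M G - rk M F))"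
proof -
  let ?N = "contraction M F"
  let ?A = "{G \<in> flats M. F \<subseteq> G}"
  have FE: "F \<subseteq> ground M" using F unfolding flats_def by auto
  have fl: "flats ?N = (\<lambda>G. G - F) ` ?A" by (rule flats_contraction[OF M FE])
  have "{} \<in> flats ?N" unfolding fl using F by blast
  then have bot: "\<Inter>(flats ?N) = {}" by blast
  have inj: "inj_on (\<lambda>G. G - F) ?A" by (rule inj_onI) blast
  have rkG: "rk ?N (G - F) = rk M G - rk M F" if "G \<in> ?A" for G
  proof -
    have "G - F \<subseteq> ground M - F" "G - F \<union> F = G" using that unfolding flats_def by auto
    then show ?thesis using rk_contraction[OF M] by metis
  qed
  have rkN: "rank ?N = rk M (ground M) - rk M F"
    using rk_contraction[OF M, of "ground M - F" F] FE by (simp add: ground_contraction Un_absorb2)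
  have le: "rk ?N (G - F) \<le> rank ?N" if "G \<in> ?A" for G
    unfolding rkG[OF that] rkN using that rk_mono[OF M, of G "ground M"]
    by (auto simp: flats_def intro: diff_le_mono)
  have "characteristic_poly ?N
      = (\<Sum>G\<in>?A. monom (mobius (flats ?N) {} (G - F)) (rank ?N - rk ?N (G - F)))"
    unfolding characteristic_poly_def bot unfolding fl by (simp add: sum.reindex[OF inj])
  also have "\<dots> = (\<Sum>G\<in>?A. monom (mobius (flats M) F G) (rank ?N - rk ?N (G - F)))"
  proof (intro sum.cong refl)
    fix G assume G: "G \<in> ?A"
    then have "finite G" using matroidD(1)[OF M] unfolding flats_def by (auto intro: finite_subset)
    then show "monom (mobius (flats ?N) {} (G - F)) (rank ?N - rk ?N (G - F)) =
        monom (mobius (flats M) F G) (rank ?N - rk ?N (G - F))"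
      unfolding fl using G by (subst mobius_quotient) auto
  qed
  finally have "rev_at (rank ?N) (characteristic_poly ?N)
      = (\<Sum>G\<in>?A. monom (mobius (flats M) F G) (rank ?N - (rank ?N - rk ?N (G - F))))"
    by (simp add: rev_at_sum rev_at_monom)
  also have "\<dots> = (\<Sum>G\<in>?A. monom (mobius (flats M) F G) (rk M G - rk M F))"
    using le rkG by (intro sum.cong refl) simp
  finally show ?thesis .
qed

lemma rank_restriction: "rank (restriction M F) = rk M F"
proof -
  have "{I. I \<subseteq> F \<and> I \<subseteq> F \<and> indep M I} = {I. I \<subseteq> F \<and> indep M I}" by auto
  then show ?thesis unfolding rk_def restriction_def by simp
qed

text \<open>Replaces the definite description by a check for a single matroid. Two solutions differ
  by a polynomial that is fixed by reversal and has degree below half the rank, hence by 0.\<close>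

lemma inverse_KL_eqI:
  assumes M: "matroid M" and q: "rank M > 0" "2 * degree q < rank M"
    and eq: "smult ((-1) ^ rank M) (rev_at (rank M) q) =
      (\<Sum>F\<in>flats M. smult ((-1) ^ rk M F) (if F = ground M then q else inverse_KL (restriction M F)) *
         (\<Sum>G\<in>{G \<in> flats M. F \<subseteq> G}. monom (mobius (flats M) F G) (rk M G - rk M F)))"
  shows "inverse_KL M = q"
proof -
  let ?r = "rank M"
  let ?s = "(-1) ^ ?r :: int"
  define c where "c F = rev_at (rank (contraction M F)) (characteristic_poly (contraction M F))" for F
  define rest where "rest = (\<Sum>F\<in>flats M - {ground M}.
    smult ((-1) ^ rank (restriction M F)) (inverse_KL (restriction M F)) * c F)"
  have fin: "finite (ground M)" by (rule matroidD(1)[OF M])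
  have c1: "c (ground M) = 1"
    unfolding c_def contraction_ground[OF M] by (simp add: rev_at_def)
  \<comment> \<open>The top flat has coefficient 1, so the unknown enters the right-hand side only
    as \<open>smult ?s p\<close>.\<close>
  have split: "(\<Sum>F\<in>flats M. smult ((-1) ^ rank (restriction M F))
      (if F = ground M then p else inverse_KL (restriction M F)) * c F) = smult ?s p + rest" for p
    unfolding rest_def
    by (subst sum.remove[OF finite_flats[OF fin] ground_in_flats])
       (simp add: c1 restriction_ground[OF M])
  have q_eq: "smult ?s (rev_at ?r q) = smult ?s q + rest"
    unfolding eq split[symmetric] c_def
    by (intro sum.cong refl) (simp only: rank_restriction rev_characteristic_poly_contraction[OF M])
  have "inverse_KL M = (THE p. 2 * degree p < ?r \<and> smult ?s (rev_at ?r p) = smult ?s p + rest)"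
    using q(1) fin by (subst inverse_KL.simps) (simp only: split[unfolded c_def] if_False simp_thms neq0_conv[symmetric])
  also have "\<dots> = q"
  proof (rule the_equality)
    show "2 * degree q < ?r \<and> smult ?s (rev_at ?r q) = smult ?s q + rest" using q_eq q by simp
  next
    fix p assume p: "2 * degree p < ?r \<and> smult ?s (rev_at ?r p) = smult ?s p + rest"
    then have "smult ?s (rev_at ?r (p - q)) = smult ?s (p - q)"
      using q_eq by (simp add: rev_at_diff smult_diff_right)
    then have "rev_at ?r (p - q) = p - q" by (rule smult_left_cancel[rotated]) simp
    moreover have "2 * degree (p - q) < ?r" using p q degree_diff_le_max[of p q] by linarith
    ultimately have "p - q = 0" by (rule rev_at_fixed_eq_0[rotated])
    then show "p = q" by simp
  qed
  finally show ?thesis .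
qed

section \<open>Three-row partitions and the coefficients\<close>

definition partitions3 :: "nat \<Rightarrow> (nat \<times> nat \<times> nat) set" where
  "partitions3 n = {(a, b, c). c \<le> b \<and> b \<le> a \<and> a + b + c = n}"

text \<open>The hook length formula; the value is also correct, namely 0, for \<open>b = a + 1\<close> and \<open>c = b + 1\<close>.\<close>

definition num_SYT :: "nat \<Rightarrow> nat \<Rightarrow> nat \<Rightarrow> rat" where
  "num_SYT a b c = (of_nat a - of_nat b + 1) * (of_nat a - of_nat c + 2) * (of_nat b - of_nat c + 1) *
     fact (a + b + c) / (fact (a + 2) * fact (b + 1) * fact c)"

lemma finite_partitions3: "finite (partitions3 n)"
  by (rule finite_subset[of _ "{..n} \<times> {..n} \<times> {..n}"]) (auto simp: partitions3_def)

lemma finite_filter_partitions3: "finite {(a, b, c). c \<le> b \<and> b \<le> a \<and> a + b + c = (n::nat) \<and> P a b c}"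
  by (rule finite_subset[OF _ finite_partitions3[of n]]) (auto simp: partitions3_def)

lemma num_SYT_eq_0:
  "0 < a \<Longrightarrow> num_SYT (a - Suc 0) a c = 0" "0 < c \<Longrightarrow> num_SYT a (c - Suc 0) c = 0"
  by (simp_all add: num_SYT_def of_nat_diff)

text \<open>The largest entry of a standard tableau sits in a removable box. Shortening a row as
  long as the next one contributes 0 by \<open>num_SYT_eq_0\<close>; only empty rows are singled
  out, because \<open>b - 1\<close> and \<open>c - 1\<close> truncate there.\<close>

lemma num_SYT_branching:
  assumes "c \<le> b" "b \<le> a" "a \<noteq> 0"
  shows "num_SYT a b c = num_SYT (a - 1) b c + (if b = 0 then 0 else num_SYT a (b - 1) c) +
    (if c = 0 then 0 else num_SYT a b (c - 1))"
proof -
  obtain a' where a': "a = Suc a'" using assms(3) by (cases a) auto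
  define n where "n = a' + b + c"
  define A B C :: rat where "A = of_nat a" and "B = of_nat b" and "C = of_nat c"
  \<comment> \<open>With this common factor all four counts are polynomials in \<open>A\<close>,
    \<open>B\<close>, \<open>C\<close> times \<open>K\<close>, and the claim becomes one polynomial
    identity.\<close>
  define K :: rat where "K = fact n / (fact (a + 2) * fact (b + 1) * fact c)"
  have N: "of_nat (Suc n) = A + B + C" unfolding A_def B_def C_def n_def a' by simp
  have fact_n: "fact (a + b + c) = (A + B + C) * fact n"
    using fact_Suc[of n, where 'a=rat] N by (simp add: n_def a')
  have 0: "num_SYT a b c = (A - B + 1) * (A - C + 2) * (B - C + 1) * (A + B + C) * K"
    unfolding num_SYT_def K_def fact_n by (simp add: A_def B_def C_def)
  have 1: "num_SYT (a - 1) b c = (A - B) * (A - C + 1) * (B - C + 1) * (A + 2) * K"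
  proof -
    have "fact (a + 2) = (A + 2) * (fact (a' + 2) :: rat)" by (simp add: a' A_def algebra_simps)
    moreover have "A + 2 \<noteq> 0" unfolding A_def by linarith
    ultimately show ?thesis
      by (simp add: num_SYT_def K_def a' n_def A_def B_def C_def) (simp add: algebra_simps)
  qed
  have 2: "(if b = 0 then 0 else num_SYT a (b - 1) c) = (A - B + 2) * (A - C + 2) * (B - C) * (B + 1) * K"
  proof (cases b)
    case 0
    \<comment> \<open>\<open>c \<le> b\<close> forces \<open>c = 0\<close>, so the factor
      \<open>B - C\<close> is 0.\<close>
    then show ?thesis using assms by (simp add: B_def C_def)
  next
    case (Suc b')
    then have "fact (b + 1) = (B + 1) * (fact (b' + 1) :: rat)" by (simp add: B_def algebra_simps)
    moreover have "B + 1 \<noteq> 0" unfolding B_def by linarith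
    ultimately show ?thesis by (simp add: num_SYT_def K_def a' Suc n_def A_def B_def C_def) (simp add: algebra_simps)
  qed
  have 3: "(if c = 0 then 0 else num_SYT a b (c - 1)) = (A - B + 1) * (A - C + 3) * (B - C + 2) * C * K"
  proof (cases c)
    case 0
    then show ?thesis by (simp add: C_def)
  next
    case (Suc c')
    then have "fact c = C * (fact c' :: rat)" by (simp add: C_def)
    moreover have "C \<noteq> 0" unfolding C_def using Suc by simp
    ultimately show ?thesis by (simp add: num_SYT_def K_def a' Suc n_def A_def B_def C_def) (simp add: algebra_simps)
  qed
  have "(A - B + 1) * (A - C + 2) * (B - C + 1) * (A + B + C) =
      (A - B) * (A - C + 1) * (B - C + 1) * (A + 2) + (A - B + 2) * (A - C + 2) * (B - C) * (B + 1)
      + (A - B + 1) * (A - C + 3) * (B - C + 2) * C"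
    by (simp add: algebra_simps)
  then show ?thesis unfolding 0 1 2 3 by (simp only: distrib_right[symmetric])
qed

text \<open>The transposed branching rule: the sum over removed boxes is regrouped by the smaller
  partition. The hypotheses on \<open>W\<close> kill the added boxes that leave no partition, as
  \<open>num_SYT_eq_0\<close> kills the removed ones.\<close>

lemma sum_partitions3_branching:
  assumes W: "\<And>a c. W a (Suc a) c = 0" "\<And>a b. W a b (Suc b) = 0"
  shows "(\<Sum>(a, b, c)\<in>partitions3 (Suc n). W a b c * num_SYT a b c) =
    (\<Sum>(a, b, c)\<in>partitions3 n. (W (Suc a) b c + W a (Suc b) c + W a b (Suc c)) * num_SYT a b c)"
proof -
  let ?P = "partitions3 (Suc n)"
  have "(\<Sum>(a, b, c)\<in>?P. W a b c * num_SYT a b c) =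
      (\<Sum>(a, b, c)\<in>?P. W a b c * num_SYT (a - 1) b c) +
      (\<Sum>(a, b, c)\<in>?P. if b = 0 then 0 else W a b c * num_SYT a (b - 1) c) +
      (\<Sum>(a, b, c)\<in>?P. if c = 0 then 0 else W a b c * num_SYT a b (c - 1))"
    unfolding sum.distrib[symmetric]
  proof (intro sum.cong refl, clarify)
    fix a b c assume "(a, b, c) \<in> ?P"
    then have "c \<le> b" "b \<le> a" "a \<noteq> 0" by (auto simp: partitions3_def)
    then show "W a b c * num_SYT a b c = W a b c * num_SYT (a - 1) b c +
        (if b = 0 then 0 else W a b c * num_SYT a (b - 1) c) +
        (if c = 0 then 0 else W a b c * num_SYT a b (c - 1))"
      by (subst num_SYT_branching) (auto simp: distrib_left)
  qed
  also have "(\<Sum>(a, b, c)\<in>?P. W a b c * num_SYT (a - 1) b c) =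
      (\<Sum>(a, b, c)\<in>partitions3 n. W (Suc a) b c * num_SYT a b c)"
    \<comment> \<open>\<open>S'\<close> and \<open>T'\<close> collect the vanishing terms without a
      partner. Lengthening the first row always gives a partition, hence the empty
      \<open>T'\<close>.\<close>
    by (rule sum.reindex_bij_witness_not_neutral[where S' = "{(a, b, c) \<in> ?P. a = b}" and T' = "{}"
          and j = "\<lambda>(a, b, c). (a - 1, b, c)" and i = "\<lambda>(a, b, c). (Suc a, b, c)"])
       (auto simp: partitions3_def num_SYT_eq_0 finite_filter_partitions3)
  also have "(\<Sum>(a, b, c)\<in>?P. if b = 0 then 0 else W a b c * num_SYT a (b - 1) c) =
      (\<Sum>(a, b, c)\<in>{(a, b, c) \<in> ?P. b \<noteq> 0}. W a b c * num_SYT a (b - 1) c)"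
    using finite_partitions3 by (intro sum.mono_neutral_cong_right) (auto split: if_splits)
  also have "\<dots> = (\<Sum>(a, b, c)\<in>partitions3 n. W a (Suc b) c * num_SYT a b c)"
    by (rule sum.reindex_bij_witness_not_neutral[where S' = "{(a, b, c) \<in> ?P. b \<noteq> 0 \<and> b = c}"
          and T' = "{(a, b, c) \<in> partitions3 n. a = b}"
          and j = "\<lambda>(a, b, c). (a, b - 1, c)" and i = "\<lambda>(a, b, c). (a, Suc b, c)"])
       (auto simp: partitions3_def num_SYT_eq_0 W finite_filter_partitions3)
  also have "(\<Sum>(a, b, c)\<in>?P. if c = 0 then 0 else W a b c * num_SYT a b (c - 1)) =
      (\<Sum>(a, b, c)\<in>{(a, b, c) \<in> ?P. c \<noteq> 0}. W a b c * num_SYT a b (c - 1))"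
    using finite_partitions3 by (intro sum.mono_neutral_cong_right) (auto split: if_splits)
  also have "\<dots> = (\<Sum>(a, b, c)\<in>partitions3 n. W a b (Suc c) * num_SYT a b c)"
    by (rule sum.reindex_bij_witness_not_neutral[where S' = "{}"
          and T' = "{(a, b, c) \<in> partitions3 n. b = c}"
          and j = "\<lambda>(a, b, c). (a, b, c - 1)" and i = "\<lambda>(a, b, c). (a, b, Suc c)"])
       (auto simp: partitions3_def W finite_filter_partitions3)
  finally show ?thesis
    by (simp add: sum.distrib[symmetric] split_def distrib_right)
qed

text \<open>The closed form comes from Gosper summation over \<open>c\<close>.\<close>

lemma sum_num_SYT_middle_row_partial:
  assumes "m + r \<le> n"
  shows "(\<Sum>c\<le>r. num_SYT (n - m - c) m c) =
    fact n / (fact (m + 1) * fact r * fact (n - m + 1 - r)) *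
    ((of_nat m + 1) * (of_nat n - 2 * of_nat m + 1) - of_nat r * (of_nat n - of_nat m + 1 - of_nat r))"
  using assms
proof (induction r)
  case 0
  define a where "a = n - m"
  have n: "n = a + m" using 0 by (simp add: a_def)
  have nz: "of_nat a + 2 \<noteq> (0::rat)" by linarith
  have "fact (a + 2) = (of_nat a + 2) * (fact (a + 1) :: rat)" by (simp add: algebra_simps)
  then have "num_SYT a m 0 = (of_nat a - of_nat m + 1) * ((of_nat a + 2) * (of_nat m + 1)) * fact n /
      ((of_nat a + 2) * fact (a + 1) * fact (m + 1))"
    by (simp add: n num_SYT_def del: fact_Suc)
  also have "\<dots> = fact n / (fact (m + 1) * fact (a + 1)) * ((of_nat m + 1) * (of_nat a - of_nat m + 1))"
    using nz by (simp add: mult_ac del: fact_Suc)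
  finally show ?case by (simp add: n del: fact_Suc)
next
  case (Suc r)
  define a where "a = n - m - Suc r"
  define A M R :: rat where "A = of_nat a" and "M = of_nat m" and "R = of_nat r"
  have n: "n = a + m + Suc r" using Suc by (simp add: a_def)
  have nz: "A + 2 \<noteq> 0" "R + 1 \<noteq> 0" unfolding A_def R_def by linarith+
  \<comment> \<open>The step to \<open>Suc r\<close> raises one factorial of the denominator and
    lowers another; this denominator is common to the old sum, the new term and the new sum.\<close>
  define K :: rat where "K = fact n / (fact (m + 1) * fact (Suc r) * fact (a + 2))"
  have f1: "fact (Suc r) = (R + 1) * (fact r :: rat)" by (simp add: R_def algebra_simps)
  have f2: "fact (a + 2) = (A + 2) * (fact (a + 1) :: rat)" by (simp add: A_def algebra_simps)
  have eqs: "n - m - Suc r = a" "n - m + 1 - r = a + 2" "n - m + 1 - Suc r = a + 1" "m + r \<le> n"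
    using n by auto
  have 1: "fact n / (fact (m + 1) * fact r * fact (a + 2)) = (R + 1) * K"
    unfolding K_def f1 using nz by simp
  have 2: "fact n / (fact (m + 1) * fact (Suc r) * fact (a + 1)) = (A + 2) * K"
    unfolding K_def f2 using nz by simp
  have 3: "num_SYT a m (Suc r) = (A - M + 1) * (A - (R + 1) + 2) * (M - (R + 1) + 1) * K"
    unfolding num_SYT_def K_def n A_def M_def R_def by (simp add: add.commute)
  have n': "of_nat n = A + M + R + 1" by (simp add: n A_def M_def R_def)
  have "(\<Sum>c\<le>Suc r. num_SYT (n - m - c) m c) =
     (R + 1) * K * ((M + 1) * (A + M + R + 1 - 2 * M + 1) - R * (A + M + R + 1 - M + 1 - R))
     + (A - M + 1) * (A - (R + 1) + 2) * (M - (R + 1) + 1) * K"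
    using Suc.IH[OF eqs(4)] unfolding sum.atMost_Suc eqs 1 3 n' M_def[symmetric] R_def[symmetric] by simp
  also have "\<dots> = (A + 2) * K * ((M + 1) * (A + M + R + 1 - 2 * M + 1)
      - (R + 1) * (A + M + R + 1 - M + 1 - (R + 1)))"
    by (simp add: algebra_simps)
  finally show ?case
    unfolding eqs 2 n' M_def[symmetric] by (simp add: R_def add.commute)
qed

text \<open>The value is \<open>n choose (2 * m)\<close> times a Catalan number, the term that is
  subtracted in \<open>KL_coeff_Suc_Suc\<close>.\<close>

lemma sum_num_SYT_middle_row:
  assumes "2 * m \<le> n"
  shows "(\<Sum>(a, b, c)\<in>{(a, b, c) \<in> partitions3 n. b = m}. num_SYT a b c) =
    fact n / (fact (m + 1) * fact m * fact (n - 2 * m))"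
proof -
  \<comment> \<open>\<open>c \<le> m\<close> and \<open>m \<le> n - m - c\<close> bound the last
    row. Whichever bound is smaller, the bracket of the partial sum cancels into a factorial and
    leaves the same value.\<close>
  define r where "r = min m (n - 2 * m)"
  have "(\<Sum>(a, b, c)\<in>{(a, b, c) \<in> partitions3 n. b = m}. num_SYT a b c) =
      (\<Sum>c\<le>r. num_SYT (n - m - c) m c)"
    by (rule sum.reindex_bij_witness[where i = "\<lambda>c. (n - m - c, m, c)" and j = "\<lambda>(a, b, c). c"])
       (use assms in \<open>auto simp: partitions3_def r_def\<close>)
  also have "\<dots> = fact n / (fact (m + 1) * fact r * fact (n - m + 1 - r)) *
    ((of_nat m + 1) * (of_nat n - 2 * of_nat m + 1) - of_nat r * (of_nat n - of_nat m + 1 - of_nat r))"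
    by (rule sum_num_SYT_middle_row_partial) (use assms in \<open>auto simp: r_def\<close>)
  also have "\<dots> = fact n / (fact (m + 1) * fact m * fact (n - 2 * m))"
  proof -
    define d where "d = n - 2 * m"
    have n: "n = d + 2 * m" using assms by (simp add: d_def)
    have nz: "of_nat d + 1 \<noteq> (0::rat)" "of_nat m + 1 \<noteq> (0::rat)" by linarith+
    show ?thesis
    proof (cases "m \<le> d")
      case True
      then have "r = m" by (simp add: r_def d_def)
      moreover have "n - m + 1 - m = Suc d" "n - 2 * m = d" by (auto simp: n)
      moreover have "fact (Suc d) = (of_nat d + 1) * (fact d :: rat)" by simp
      moreover have "(of_nat m + 1) * (of_nat n - 2 * of_nat m + 1) - of_nat m * (of_nat n - of_nat m + 1 - of_nat m)
          = (of_nat d + 1 :: rat)" by (simp add: n algebra_simps)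
      ultimately show ?thesis using nz by (simp del: fact_Suc)
    next
      case False
      then have "r = d" by (simp add: r_def d_def)
      moreover have "n - m + 1 - d = Suc m" "n - 2 * m = d" by (auto simp: n)
      moreover have "fact (Suc m) = (of_nat m + 1) * (fact m :: rat)" by simp
      moreover have "(of_nat m + 1) * (of_nat n - 2 * of_nat m + 1) - of_nat d * (of_nat n - of_nat m + 1 - of_nat d)
          = (of_nat m + 1 :: rat)" by (simp add: n algebra_simps)
      ultimately show ?thesis using nz by (simp add: mult_ac del: fact_Suc)
    qed
  qed
  finally show ?thesis .
qed

section \<open>Ballot numbers and the recurrence for the coefficients\<close>

definition ballot :: "nat \<Rightarrow> nat \<Rightarrow> int" where
  "ballot s k = int (s choose k) - (if k = 0 then 0 else int (s choose (k - 1)))"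

text \<open>The sum starts at \<open>2 * k\<close> because \<open>R\<^sub>s\<close> has only
  exponents up to \<open>s div 2\<close>.\<close>

definition KL_coeff :: "nat \<Rightarrow> nat \<Rightarrow> int" where
  "KL_coeff n k = (\<Sum>s = 2 * k..n. int (n choose s) * ballot s k)"

text \<open>The two middle binomials of an odd row agree. This lets the lower limit in
  \<open>KL_coeff n (Suc k)\<close> drop by one.\<close>

lemma ballot_odd_half: "ballot (2 * k + 1) (Suc k) = 0"
  using binomial_symmetric[of k "2 * k + 1"] by (simp add: ballot_def)

lemma ballot_Suc: "ballot (Suc s) (Suc k) = ballot s (Suc k) + ballot s k"
  by (cases k) (simp_all add: ballot_def)

lemma KL_coeff_altdef:
  assumes "n \<le> N" 
  shows "KL_coeff n k = (\<Sum>s = 2 * k..N. int (n choose s) * ballot s k)"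
  unfolding KL_coeff_def using assms
  by (intro sum.mono_neutral_left) (auto simp: binomial_eq_0)

lemma KL_coeff_Suc_0: "KL_coeff (Suc n) 0 = 2 * KL_coeff n 0"
proof -
  have "KL_coeff n 0 = 2 ^ n" for n
    using choose_row_sum[of n] unfolding KL_coeff_def ballot_def
    by (simp add: atLeast0AtMost flip: of_nat_sum)
  then show ?thesis by simp
qed

text \<open>Pascal's rule for the binomial and for the ballot number splits the sum into three. The
  subtracted term makes up for a lower limit that is one too high for
  \<open>KL_coeff n k\<close>.\<close>

lemma KL_coeff_Suc_Suc:
  "KL_coeff (Suc n) (Suc k) = 2 * KL_coeff n (Suc k) + KL_coeff n k
     - int (n choose (2 * k)) * ballot (2 * k) k"
proof -
  let ?b = "\<lambda>s. int (n choose s) * ballot s (Suc k)"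
  have "KL_coeff (Suc n) (Suc k) = (\<Sum>s = Suc (2 * k + 1)..Suc n. int (Suc n choose s) * ballot s (Suc k))"
    by (simp add: KL_coeff_def)
  also have "\<dots> = (\<Sum>s = 2 * k + 1..n. int (Suc n choose Suc s) * ballot (Suc s) (Suc k))"
    by (rule sum.shift_bounds_cl_Suc_ivl)
  also have "\<dots> = (\<Sum>s = 2 * k + 1..n. int (n choose Suc s) * ballot (Suc s) (Suc k)) +
      (\<Sum>s = 2 * k + 1..n. ?b s) + (\<Sum>s = 2 * k + 1..n. int (n choose s) * ballot s k)"
    unfolding sum.distrib[symmetric]
    by (intro sum.cong refl) (simp add: ballot_Suc algebra_simps)
  \<comment> \<open>After the shift the upper limit is \<open>Suc n\<close>, and
    \<open>n choose Suc n\<close> is 0.\<close>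
  also have "(\<Sum>s = 2 * k + 1..n. int (n choose Suc s) * ballot (Suc s) (Suc k)) = KL_coeff n (Suc k)"
  proof -
    have "2 * Suc k = Suc (2 * k + 1)" by simp
    then show ?thesis
      using KL_coeff_altdef[of n "Suc n" "Suc k"] by (simp only: sum.shift_bounds_cl_Suc_ivl le_SucI le_refl)
  qed
  \<comment> \<open>The extra term \<open>s = 2 * k + 1\<close> is 0 by
    \<open>ballot_odd_half\<close>.\<close>
  also have "(\<Sum>s = 2 * k + 1..n. ?b s) = KL_coeff n (Suc k)"
    unfolding KL_coeff_def
    by (rule sum.mono_neutral_right)
       (auto simp: ballot_odd_half[simplified] dest!: le_neq_implies_less simp: not_le)
  also have "(\<Sum>s = 2 * k + 1..n. int (n choose s) * ballot s k) =
      KL_coeff n k - int (n choose (2 * k)) * ballot (2 * k) k"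
    unfolding KL_coeff_def by (cases "2 * k \<le> n") (simp_all add: sum.atLeast_Suc_atMost)
  finally show ?thesis by simp
qed

text \<open>\<open>ballot (2 * k) k\<close> is a Catalan number. The value agrees with
  \<open>sum_num_SYT_middle_row\<close>, which matches the correction terms of the two
  recurrences.\<close>

lemma choose_mult_ballot_middle:
  assumes "2 * k \<le> n"
  shows "of_int (int (n choose (2 * k)) * ballot (2 * k) k) =
    (fact n / (fact (k + 1) * fact k * fact (n - 2 * k)) :: rat)"
proof -
  have "of_int (ballot (2 * k) k) = (fact (2 * k) / (fact (k + 1) * fact k) :: rat)"
  proof (cases k)
    case (Suc j)
    have e: "2 * Suc j - Suc j = Suc j" "2 * Suc j - j = Suc (Suc j)" by auto
    have f: "fact (Suc (Suc j)) = (of_nat j + 2) * (of_nat j + 1) * (fact j :: rat)"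
      "fact (Suc j) = (of_nat j + 1) * (fact j :: rat)"
      by (simp_all add: algebra_simps)
    have nz: "of_nat j + 2 \<noteq> (0::rat)" "of_nat j + 1 \<noteq> (0::rat)" by linarith+
    have "of_int (ballot (2 * k) k) = (of_nat (2 * Suc j choose Suc j) - of_nat (2 * Suc j choose j) :: rat)"
      by (simp add: ballot_def Suc)
    also have "\<dots> = fact (2 * Suc j) / (fact (Suc j) * fact (Suc j)) - fact (2 * Suc j) / (fact j * fact (Suc (Suc j)))"
      by (subst (1 2) binomial_fact) (simp_all only: e, simp_all)
    also have "\<dots> = fact (2 * Suc j) / (fact (Suc (Suc j)) * fact (Suc j))"
      unfolding f using nz by (simp add: divide_simps) (simp add: algebra_simps)
    finally show ?thesis by (simp add: Suc)
  qed (simp add: ballot_def)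
  moreover have "of_nat (n choose (2 * k)) = (fact n / (fact (2 * k) * fact (n - 2 * k)) :: rat)"
    using assms by (rule binomial_fact)
  ultimately show ?thesis by simp
qed

text \<open>The number of partitions \<open>(s - k, k)\<close> such that \<open>(a, b, c) / (s - k, k)\<close> is a horizontal strip.\<close>

definition strip_count :: "nat \<Rightarrow> nat \<Rightarrow> nat \<Rightarrow> nat \<Rightarrow> rat" where
  "strip_count k a b c = (if c \<le> k \<and> k \<le> b then of_nat a - of_nat b + 1 else 0)"

text \<open>Both sides obey one recurrence in \<open>n\<close>. For \<open>k = Suc j\<close> the
  weights of the three ways to add a box sum to twice the weight for \<open>Suc j\<close> plus the
  weight for \<open>j\<close>, less 1 exactly where \<open>b = j\<close>; this defect is the term
  subtracted in \<open>KL_coeff_Suc_Suc\<close>.\<close>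

lemma KL_coeff_eq_sum_partitions3:
  "of_int (KL_coeff n k) = (\<Sum>(a, b, c)\<in>partitions3 n. strip_count k a b c * num_SYT a b c)"
proof (induction n arbitrary: k)
  case 0
  have "partitions3 0 = {(0, 0, 0)}" by (auto simp: partitions3_def)
  then show ?case by (cases k) (simp_all add: KL_coeff_def strip_count_def num_SYT_def ballot_def fact_numeral)
next
  case (Suc n)
  have step: "(\<Sum>(a, b, c)\<in>partitions3 (Suc n). strip_count k a b c * num_SYT a b c) =
    (\<Sum>(a, b, c)\<in>partitions3 n. (strip_count k (Suc a) b c + strip_count k a (Suc b) c
       + strip_count k a b (Suc c)) * num_SYT a b c)"
    \<comment> \<open>The factor \<open>a - b + 1\<close> is 0 for \<open>b = a + 1\<close>, and
      \<open>c = b + 1\<close> leaves no \<open>k\<close> between \<open>c\<close> and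
      \<open>b\<close>.\<close>
    by (rule sum_partitions3_branching) (auto simp: strip_count_def)
  show ?case
  proof (cases k)
    case 0
    have "of_int (KL_coeff (Suc n) 0) = 2 * (\<Sum>(a, b, c)\<in>partitions3 n. strip_count 0 a b c * num_SYT a b c)"
      by (simp add: KL_coeff_Suc_0 Suc.IH)
    also have "\<dots> = (\<Sum>(a, b, c)\<in>partitions3 (Suc n). strip_count k a b c * num_SYT a b c)"
      unfolding step unfolding sum_distrib_left 0
      by (intro sum.cong refl) (auto simp: strip_count_def algebra_simps)
    finally show ?thesis by (simp add: 0)
  next
    case k: (Suc j)
    let ?S = "{(a, b, c) \<in> partitions3 n. b = j}"
    have "of_int (int (n choose (2 * j)) * ballot (2 * j) j) = (\<Sum>(a, b, c)\<in>?S. num_SYT a b c)"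
    proof (cases "2 * j \<le> n")
      case True
      then show ?thesis by (simp only: choose_mult_ballot_middle sum_num_SYT_middle_row)
    next
      case False
      then have "?S = {}" by (auto simp: partitions3_def)
      then have "(\<Sum>(a, b, c)\<in>?S. num_SYT a b c) = 0" by (simp only: sum.empty)
      then show ?thesis using False by (simp add: binomial_eq_0)
    qed
    also have "\<dots> = (\<Sum>(a, b, c)\<in>partitions3 n. (if b = j then 1 else 0) * num_SYT a b c)"
      by (rule sum.mono_neutral_cong_left) (auto simp: finite_partitions3 split: if_splits)
    finally have mid: "of_int (int (n choose (2 * j)) * ballot (2 * j) j) =
      (\<Sum>(a, b, c)\<in>partitions3 n. (if b = j then 1 else 0) * num_SYT a b c)" .
    have "of_int (KL_coeff (Suc n) k) = 2 * of_int (KL_coeff n (Suc j)) + of_int (KL_coeff n j)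
        - (of_int (int (n choose (2 * j)) * ballot (2 * j) j) :: rat)"
      unfolding k KL_coeff_Suc_Suc by simp
    also have "\<dots> = (\<Sum>(a, b, c)\<in>partitions3 (Suc n). strip_count k a b c * num_SYT a b c)"
      unfolding step unfolding mid Suc.IH sum_distrib_left sum.distrib[symmetric] sum_subtractf[symmetric] k
      by (intro sum.cong refl) (auto simp: strip_count_def partitions3_def algebra_simps)
    finally show ?thesis .
  qed
qed

section \<open>The candidate polynomials and their functional equation\<close>

definition ballot_poly :: "nat \<Rightarrow> int poly" where
  "ballot_poly s = (\<Sum>k\<le>s div 2. monom (ballot s k) k)"

definition thagomizer_poly :: "nat \<Rightarrow> int poly" where
  "thagomizer_poly n = (\<Sum>s\<le>n. of_nat (n choose s) * ballot_poly s)"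

lemma coeff_ballot_poly: "coeff (ballot_poly s) k = (if 2 * k \<le> s then ballot s k else 0)"
  unfolding ballot_poly_def coeff_sum coeff_monom by auto

lemma coeff_of_nat_mult_poly: "coeff (of_nat c * p) k = of_nat c * coeff p k"
  by (simp add: of_nat_poly)

lemma coeff_thagomizer_poly: "coeff (thagomizer_poly n) k = KL_coeff n k"
  unfolding thagomizer_poly_def KL_coeff_def coeff_sum coeff_of_nat_mult_poly coeff_ballot_poly
  by (rule sum.mono_neutral_cong_right) auto

lemma degree_thagomizer_poly: "2 * degree (thagomizer_poly n) \<le> n"
proof -
  have "degree (thagomizer_poly n) \<le> n div 2"
    by (rule degree_le) (auto simp: coeff_thagomizer_poly KL_coeff_def)
  then show ?thesis by linarith
qed

lemma coeff_ballot_product: "coeff ([:1, -1:] * [:1, 1:] ^ s :: int poly) k = ballot s k"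
proof -
  have "coeff ([:1, 1:] ^ s :: int poly) i = int (s choose i)" for i
    by (cases "i \<le> s") (simp_all add: coeff_linear_poly_power coeff_eq_0 degree_linear_power)
  then show ?thesis by (cases k) (simp_all add: ballot_def)
qed

text \<open>Coefficient form of the fact that \<open>(1 - t) (1 + t)^s\<close> changes sign under
  reversal in degree \<open>s + 1\<close>.\<close>

lemma ballot_antisym:
  assumes "k \<le> Suc s"
  shows "ballot s (Suc s - k) = - ballot s k"
proof (cases "k = 0 \<or> k = Suc s")
  case False
  then obtain j where j: "k = Suc j" "Suc j \<le> s" using assms by (cases k) auto
  have "s choose (s - j) = s choose j" "s choose (s - Suc j) = s choose Suc j"
    using j by (simp_all add: binomial_symmetric[symmetric])
  then show ?thesis using j by (simp add: ballot_def)
qed (auto simp: ballot_def)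

text \<open>Subtracting the whole product from its lower half leaves minus the upper half, which is
  the reversed lower half by \<open>ballot_antisym\<close>.\<close>

lemma rev_at_ballot_poly:
  "rev_at (Suc s) (ballot_poly s) = ballot_poly s + [:-1, 1:] * [:1, 1:] ^ s"
proof -
  have "[:-1, 1:] * [:1, 1:] ^ s = - ([:1, -1:] * [:1, 1:] ^ s :: int poly)" by simp
  moreover have "rev_at (Suc s) (ballot_poly s) = ballot_poly s - [:1, -1:] * [:1, 1:] ^ s"
  proof (rule poly_eqI)
    fix i
    have "ballot s i = 0" if "i > Suc s" using that by (simp add: ballot_def binomial_eq_0)
    \<comment> \<open>For odd \<open>s\<close> the exponent \<open>i\<close> is its own mirror
      image, so its coefficient equals its negative.\<close>
    moreover have "ballot s i = 0" if "2 * i = Suc s"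
    proof -
      have "Suc s - i = i" using that by simp
      then show ?thesis using ballot_antisym[of i s] that by simp
    qed
    ultimately show "coeff (rev_at (Suc s) (ballot_poly s)) i =
        coeff (ballot_poly s - [:1, -1:] * [:1, 1:] ^ s) i"
      unfolding coeff_diff coeff_ballot_product coeff_rev_at coeff_ballot_poly
      using ballot_antisym[of i s] by (cases "2 * i = Suc s") auto
  qed
  ultimately show ?thesis by simp
qed

lemma rev_at_shift:
  assumes "degree p \<le> d" "d \<le> r"
  shows "rev_at r p = monom 1 (r - d) * rev_at d p"
  by (rule poly_eqI) (use assms in \<open>auto simp: coeff_rev_at coeff_monom_mult coeff_eq_0\<close>)

lemma rev_at_of_nat_mult: "rev_at r (of_nat c * p) = of_nat c * rev_at r p"
  by (rule poly_eqI) (simp add: coeff_rev_at coeff_of_nat_mult_poly)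

text \<open>On exponential generating functions the transforms multiply by \<open>exp x\<close> and
  then by \<open>exp (y x)\<close>, together by \<open>exp ((y + 1) x)\<close>.\<close>

lemma binomial_transform_compose:
  fixes y :: "'a::comm_ring_1"
  shows "(\<Sum>s\<le>n. of_nat (n choose s) * y ^ (n - s) * (\<Sum>j\<le>s. of_nat (s choose j) * r j)) =
    (\<Sum>j\<le>n. of_nat (n choose j) * (y + 1) ^ (n - j) * r j)"
proof -
  have inner: "(\<Sum>s\<le>n. of_nat (n choose s) * y ^ (n - s) * of_nat (s choose j)) =
      of_nat (n choose j) * (y + 1) ^ (n - j)" if j: "j \<le> n" for j
  proof -
    have "(\<Sum>s\<le>n. of_nat (n choose s) * y ^ (n - s) * of_nat (s choose j)) =
        (\<Sum>s = j..n. of_nat (n choose s) * y ^ (n - s) * of_nat (s choose j))"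
      by (rule sum.mono_neutral_right) (auto simp: binomial_eq_0)
    also have "\<dots> = (\<Sum>u\<le>n - j. of_nat (n choose (u + j)) * y ^ (n - (u + j)) * of_nat (u + j choose j))"
      by (rule sum.reindex_bij_witness[where i = "\<lambda>u. u + j" and j = "\<lambda>s. s - j"]) (use j in auto)
    also have "\<dots> = (\<Sum>u\<le>n - j. of_nat (n choose j) * (of_nat (n - j choose u) * 1 ^ u * y ^ (n - j - u)))"
    proof (intro sum.cong refl)
      fix u assume "u \<in> {..n - j}"
      \<comment> \<open>Trinomial revision: the \<open>j\<close>-subset is chosen first.\<close>
      then have "(n choose (u + j)) * (u + j choose j) = (n choose j) * (n - j choose u)"
        using j choose_mult[of j "u + j" n] by simp
      then have e: "of_nat (n choose (u + j)) * of_nat (u + j choose j) =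
          (of_nat (n choose j) * of_nat (n - j choose u) :: 'a)"
        by (simp flip: of_nat_mult)
      have "of_nat (n choose (u + j)) * y ^ (n - (u + j)) * of_nat (u + j choose j) =
          of_nat (n choose (u + j)) * of_nat (u + j choose j) * y ^ (n - (u + j))"
        by (simp only: mult_ac)
      also have "\<dots> = of_nat (n choose j) * (of_nat (n - j choose u) * 1 ^ u * y ^ (n - j - u))"
        unfolding e by (simp add: mult.assoc add.commute)
      finally show "of_nat (n choose (u + j)) * y ^ (n - (u + j)) * of_nat (u + j choose j) =
          of_nat (n choose j) * (of_nat (n - j choose u) * 1 ^ u * y ^ (n - j - u))" .
    qed
    also have "\<dots> = of_nat (n choose j) * (y + 1) ^ (n - j)"
      unfolding sum_distrib_left[symmetric] binomial_ring[symmetric] by (simp add: add.commute)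
    finally show ?thesis .
  qed
  have "(\<Sum>s\<le>n. of_nat (n choose s) * y ^ (n - s) * (\<Sum>j\<le>s. of_nat (s choose j) * r j)) =
      (\<Sum>s\<le>n. \<Sum>j\<le>n. of_nat (n choose s) * y ^ (n - s) * of_nat (s choose j) * r j)"
    unfolding sum_distrib_left
    by (rule sum.cong[OF refl], rule sum.mono_neutral_cong_left) (auto simp: binomial_eq_0 mult_ac)
  also have "\<dots> = (\<Sum>j\<le>n. (\<Sum>s\<le>n. of_nat (n choose s) * y ^ (n - s) * of_nat (s choose j)) * r j)"
    unfolding sum_distrib_right by (rule sum.swap)
  finally show ?thesis by (simp add: inner)
qed

lemma rev_at_thagomizer_poly:
  "rev_at (Suc n) (thagomizer_poly n) =
    (\<Sum>s\<le>n. of_nat (n choose s) * [:-1, 1:] ^ (n - s) * thagomizer_poly s) + [:-1, 1:] * [:1, 2:] ^ n"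
proof -
  have deg: "degree (ballot_poly s) \<le> Suc s" for s
    by (rule degree_le) (simp add: coeff_ballot_poly)
  have X: "monom 1 k = [:0, 1:] ^ k" for k :: nat by (simp add: monom_altdef)
  have "rev_at (Suc n) (thagomizer_poly n) =
      (\<Sum>s\<le>n. of_nat (n choose s) * rev_at (Suc n) (ballot_poly s))"
    unfolding thagomizer_poly_def by (simp add: rev_at_sum rev_at_of_nat_mult)
  \<comment> \<open>Each summand is reversed in its own degree \<open>Suc s\<close>; the remaining
    \<open>n - s\<close> degrees give a power of \<open>t\<close>.\<close>
  also have "\<dots> = (\<Sum>s\<le>n. of_nat (n choose s) * ([:0, 1:] ^ (n - s) *
      (ballot_poly s + [:-1, 1:] * [:1, 1:] ^ s)))"
    by (intro sum.cong refl) (simp add: rev_at_shift[OF deg] rev_at_ballot_poly X del: mult_pCons_left)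
  also have "\<dots> = (\<Sum>s\<le>n. of_nat (n choose s) * [:0, 1:] ^ (n - s) * ballot_poly s) +
      [:-1, 1:] * (\<Sum>s\<le>n. of_nat (n choose s) * [:1, 1:] ^ s * [:0, 1:] ^ (n - s))"
    unfolding sum_distrib_left sum.distrib[symmetric]
    by (intro sum.cong refl) (simp only: distrib_left mult_ac)
  also have "(\<Sum>s\<le>n. of_nat (n choose s) * [:1, 1:] ^ s * [:0, 1:] ^ (n - s)) = [:1, 2:: int:] ^ n"
    unfolding binomial_ring[symmetric] by simp
  \<comment> \<open>With \<open>t\<close> read as \<open>(t - 1) + 1\<close>,
    \<open>binomial_transform_compose\<close> turns the right-hand side into the left one.\<close>
  also have "(\<Sum>s\<le>n. of_nat (n choose s) * [:0, 1:] ^ (n - s) * ballot_poly s) =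
      (\<Sum>s\<le>n. of_nat (n choose s) * [:-1, 1:] ^ (n - s) * thagomizer_poly s)"
    unfolding thagomizer_poly_def binomial_transform_compose by (simp add: one_pCons)
  finally show ?thesis .
qed

section \<open>The matroid \<open>T\<^sub>S\<close> and its flats\<close>

definition hub :: "vertex set" where "hub = {VA, VB}"
definition spokeA :: "nat \<Rightarrow> vertex set" where "spokeA j = {VA, VN j}"
definition spokeB :: "nat \<Rightarrow> vertex set" where "spokeB j = {VB, VN j}"

text \<open>A set of labels instead of a number keeps the family closed under restriction to flats
  containing \<open>hub\<close>, as the induction in \<open>inverse_KL_thag\<close>
  requires.\<close>

definition thag_edges :: "nat set \<Rightarrow> vertex set set" where
  "thag_edges S = insert hub (spokeA ` S \<union> spokeB ` S)"

definition ends :: "vertex set set \<Rightarrow> nat set" where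
  "ends X = {j. spokeA j \<in> X \<or> spokeB j \<in> X}"

definition doubles :: "vertex set set \<Rightarrow> nat set" where
  "doubles X = {j. spokeA j \<in> X \<and> spokeB j \<in> X}"

lemma edge_eq_iff [simp]:
  "spokeA i = spokeA j \<longleftrightarrow> i = j" "spokeB i = spokeB j \<longleftrightarrow> i = j"
  "spokeA i \<noteq> spokeB j" "spokeB i \<noteq> spokeA j"
  "spokeA i \<noteq> hub" "spokeB i \<noteq> hub" "hub \<noteq> spokeA i" "hub \<noteq> spokeB i"
  by (auto simp: hub_def spokeA_def spokeB_def doubleton_eq_iff)

lemma inj_spoke: "inj_on spokeA S" "inj_on spokeB S"
  by (auto intro: inj_onI)

lemma thag_edges_iff [simp]:
  "hub \<in> thag_edges S" "spokeA j \<in> thag_edges S \<longleftrightarrow> j \<in> S" "spokeB j \<in> thag_edges S \<longleftrightarrow> j \<in> S"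
  by (auto simp: thag_edges_def)

lemma thag_edgesE:
  assumes "e \<in> thag_edges S"
  obtains "e = hub" | j where "e = spokeA j" "j \<in> S" | j where "e = spokeB j" "j \<in> S"
  using assms by (auto simp: thag_edges_def)

lemma thag_edges_subset_iff [simp]: "thag_edges A \<subseteq> thag_edges B \<longleftrightarrow> A \<subseteq> B"
proof
  assume "thag_edges A \<subseteq> thag_edges B"
  then show "A \<subseteq> B" using thag_edges_iff(2) by blast
qed (auto simp: thag_edges_def)

lemma K11_edges_eq: "K11_edges n = thag_edges {1..n}"
proof -
  have "spokeA ` {1..n} = {{VA, VN j} |j. 1 \<le> j \<and> j \<le> n}"
    "spokeB ` {1..n} = {{VB, VN j} |j. 1 \<le> j \<and> j \<le> n}"
    by (auto simp: spokeA_def spokeB_def)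
  then show ?thesis by (simp add: K11_edges_def thag_edges_def hub_def)
qed

section \<open>Cycles and independent sets\<close>

lemma cycle_neighbours:
  assumes "is_cycle X p" "v \<in> set p"
  obtains u w where "u \<in> set p" "w \<in> set p" "u \<noteq> w" "u \<noteq> v" "w \<noteq> v" "{u, v} \<in> X" "{w, v} \<in> X"
proof -
  let ?n = "length p"
  have n: "3 \<le> ?n" and d: "distinct p" and
    e: "\<And>i. i < ?n \<Longrightarrow> {p ! i, p ! (Suc i mod ?n)} \<in> X"
    using assms(1) unfolding is_cycle_def by auto
  obtain i where i: "i < ?n" "v = p ! i" using assms(2) by (auto simp: in_set_conv_nth)
  \<comment> \<open>\<open>l\<close> and \<open>r\<close> are the cyclic predecessor and successor
    of position \<open>i\<close>; they differ because a cycle has at least three vertices.\<close>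
  define l where "l = (if i = 0 then ?n - 1 else i - 1)"
  define r where "r = (if i = ?n - 1 then 0 else Suc i)"
  have lr: "l < ?n" "r < ?n" "l \<noteq> i" "r \<noteq> i" "l \<noteq> r" using i n by (auto simp: l_def r_def)
  have "Suc i mod ?n = r"
  proof (cases "i = ?n - 1")
    case True
    then have "Suc i = ?n" using i by simp
    then show ?thesis using True by (simp add: r_def)
  qed (use i in \<open>simp add: r_def\<close>)
  moreover have "Suc l mod ?n = i" using i n by (auto simp: l_def)
  ultimately have "{p ! l, v} \<in> X" "{p ! r, v} \<in> X"
    using e[OF lr(1)] e[OF i(1)] i(2) by (simp_all add: insert_commute)
  moreover have "p ! l \<noteq> p ! r" "p ! l \<noteq> v" "p ! r \<noteq> v"
    using lr i d by (auto simp: nth_eq_iff_index_eq)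
  ultimately show ?thesis using that[of "p ! l" "p ! r"] lr by simp
qed

text \<open>The only possible cycles are the triangles \<open>A B j\<close> and the quadrilaterals
  \<open>A i B j\<close>.\<close>

lemma acyclic_iff:
  assumes X: "X \<subseteq> thag_edges S"
  shows "(\<nexists>p. is_cycle X p) \<longleftrightarrow>
    (hub \<in> X \<longrightarrow> doubles X = {}) \<and> (\<forall>i\<in>doubles X. \<forall>j\<in>doubles X. i = j)"
proof (intro iffI conjI)
  assume acyc: "\<nexists>p. is_cycle X p"
  have False if "hub \<in> X" "j \<in> doubles X" for j
  proof -
    have "is_cycle X [VA, VB, VN j]"
      using that unfolding is_cycle_def doubles_def hub_def spokeA_def spokeB_def
      by (auto simp: less_Suc_eq insert_commute)
    then show False using acyc by blast
  qed
  then show "hub \<in> X \<longrightarrow> doubles X = {}" by blast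
  have False if "i \<in> doubles X" "j \<in> doubles X" "i \<noteq> j" for i j
  proof -
    have "is_cycle X [VA, VN i, VB, VN j]"
      using that unfolding is_cycle_def doubles_def hub_def spokeA_def spokeB_def
      by (auto simp: less_Suc_eq insert_commute)
    then show False using acyc by blast
  qed
  then show "\<forall>i\<in>doubles X. \<forall>j\<in>doubles X. i = j" by blast
next
  assume R: "(hub \<in> X \<longrightarrow> doubles X = {}) \<and> (\<forall>i\<in>doubles X. \<forall>j\<in>doubles X. i = j)"
  have nbr_VN: "u = VA \<and> spokeA j \<in> X \<or> u = VB \<and> spokeB j \<in> X" if "{u, VN j} \<in> X" for u j
    using subsetD[OF X that]
  proof (rule thag_edgesE)
    fix i assume e: "{u, VN j} = spokeA i"
    then have "u = VA" by (auto simp: spokeA_def doubleton_eq_iff)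
    then show ?thesis using that by (simp add: spokeA_def)
  next
    fix i assume e: "{u, VN j} = spokeB i"
    then have "u = VB" by (auto simp: spokeB_def doubleton_eq_iff)
    then show ?thesis using that by (simp add: spokeB_def)
  qed (simp add: hub_def doubleton_eq_iff)
  have nbr_VA: "\<exists>i. u = VN i" if "{u, VA} \<in> X" "hub \<notin> X" for u
    using subsetD[OF X that(1)]
  proof (rule thag_edgesE)
    assume "{u, VA} = hub"
    then show ?thesis using that by simp
  qed (auto simp: spokeA_def spokeB_def doubleton_eq_iff)
  show "\<nexists>p. is_cycle X p"
  proof
    assume "\<exists>p. is_cycle X p"
    then obtain p where p: "is_cycle X p" by blast
    have VN: "j \<in> doubles X \<and> VA \<in> set p" if vj: "VN j \<in> set p" for j
    proof -
      obtain u w where "u \<in> set p" "w \<in> set p" "u \<noteq> w" "{u, VN j} \<in> X" "{w, VN j} \<in> X"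
        using cycle_neighbours[OF p vj] by blast
      then show ?thesis using nbr_VN[of u j] nbr_VN[of w j] by (auto simp: doubles_def)
    qed
    \<comment> \<open>Three distinct vertices do not fit into \<open>{VA, VB}\<close>, so the cycle
      visits some \<open>VN j\<close>.\<close>
    have "\<not> set p \<subseteq> {VA, VB}"
    proof
      assume "set p \<subseteq> {VA, VB}"
      then have "card (set p) \<le> card {VA, VB}" by (intro card_mono) auto
      then show False using p by (simp add: is_cycle_def distinct_card)
    qed
    then obtain v where "v \<in> set p" "v \<noteq> VA" "v \<noteq> VB" by blast
    then obtain j where "VN j \<in> set p" using vertex.exhaust[of v] by metis
    \<comment> \<open>A double excludes \<open>hub\<close>, so the two neighbours of
      \<open>VA\<close> on the cycle are distinct vertices \<open>VN i\<close> and
      \<open>VN k\<close>, and both are doubles.\<close>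
    then have "j \<in> doubles X" "VA \<in> set p" using VN by auto
    moreover from this have "hub \<notin> X" using R by auto
    moreover obtain u w where "u \<in> set p" "w \<in> set p" "u \<noteq> w" "{u, VA} \<in> X" "{w, VA} \<in> X"
      using cycle_neighbours[OF p \<open>VA \<in> set p\<close>] by blast
    ultimately obtain i k where "VN i \<in> set p" "VN k \<in> set p" "i \<noteq> k"
      using nbr_VA[of u] nbr_VA[of w] by blast
    then show False using R VN by blast
  qed
qed

section \<open>Augmentation and rank in \<open>thag S\<close>\<close>

definition thag :: "nat set \<Rightarrow> vertex set matroid" where
  "thag S = graphic_matroid (thag_edges S)"

lemma ground_thag [simp]: "ground (thag S) = thag_edges S"
  by (simp add: thag_def graphic_matroid_def)

lemma indep_thag_iff:
  "indep (thag S) X \<longleftrightarrow> X \<subseteq> thag_edges S \<and>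
    (hub \<in> X \<longrightarrow> doubles X = {}) \<and> (\<forall>i\<in>doubles X. \<forall>j\<in>doubles X. i = j)"
proof (cases "X \<subseteq> thag_edges S")
  case True
  then show ?thesis unfolding acyclic_iff[OF True, symmetric] by (simp add: thag_def graphic_matroid_def)
qed (simp add: thag_def graphic_matroid_def)

lemma finite_thag_edges [simp]: "finite S \<Longrightarrow> finite (thag_edges S)"
  by (simp add: thag_edges_def)

lemma ends_subset: "X \<subseteq> thag_edges S \<Longrightarrow> ends X \<subseteq> S"
  by (auto simp: ends_def)

lemma card_edges:
  assumes "finite S" "X \<subseteq> thag_edges S"
  shows "card X = card (ends X) + card (doubles X) + (if hub \<in> X then 1 else 0)"
proof -
  let ?A = "{j. spokeA j \<in> X}" and ?B = "{j. spokeB j \<in> X}"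
  have fin: "finite ?A" "finite ?B"
    using assms(2) by (auto intro!: finite_subset[OF _ assms(1)] dest: subsetD)
  have X: "X = (X \<inter> {hub}) \<union> (spokeA ` ?A \<union> spokeB ` ?B)"
    using assms(2) by (auto simp: thag_edges_def)
  have "card X = card (X \<inter> {hub}) + card (spokeA ` ?A \<union> spokeB ` ?B)"
    by (subst X, rule card_Un_disjoint) (use fin in auto)
  also have "card (spokeA ` ?A \<union> spokeB ` ?B) = card ?A + card ?B"
    using fin by (subst card_Un_disjoint) (auto simp: card_image inj_spoke)
  also have "\<dots> = card (?A \<union> ?B) + card (?A \<inter> ?B)" by (rule card_Un_Int[OF fin])
  also have "?A \<union> ?B = ends X" by (auto simp: ends_def)
  also have "?A \<inter> ?B = doubles X" by (auto simp: doubles_def)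
  finally show ?thesis by auto
qed

text \<open>1 if \<open>A\<close> and \<open>B\<close> are connected by \<open>X\<close>.\<close>

definition closes :: "vertex set set \<Rightarrow> nat" where
  "closes X = (if hub \<in> X \<or> doubles X \<noteq> {} then 1 else 0)"

lemma card_indep_thag:
  assumes "finite S" "indep (thag S) X"
  shows "card X = card (ends X) + closes X"
proof -
  have X: "X \<subseteq> thag_edges S" "hub \<in> X \<longrightarrow> doubles X = {}" "\<forall>i\<in>doubles X. \<forall>j\<in>doubles X. i = j"
    using assms(2) by (auto simp: indep_thag_iff)
  have "card (doubles X) = (if doubles X = {} then 0 else 1)"
  proof (cases "doubles X = {}")
    case False
    then obtain i where "doubles X = {i}" using X(3) by blast
    then show ?thesis by simp
  qed simp
  then show ?thesis using card_edges[OF assms(1) X(1)] X(2) by (auto simp: closes_def)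
qed

lemma ends_insert [simp]:
  "ends (insert hub X) = ends X" "ends (insert (spokeA j) X) = insert j (ends X)"
  "ends (insert (spokeB j) X) = insert j (ends X)"
  by (auto simp: ends_def)

lemma doubles_insert [simp]:
  "doubles (insert hub X) = doubles X"
  "doubles (insert (spokeA j) X) = (if spokeB j \<in> X then insert j (doubles X) else doubles X)"
  "doubles (insert (spokeB j) X) = (if spokeA j \<in> X then insert j (doubles X) else doubles X)"
  unfolding doubles_def by auto

text \<open>For augmentation, \<open>card_indep_thag\<close> shows that a larger \<open>J\<close>
  touches a label outside \<open>ends I\<close> or connects \<open>A\<close> and \<open>B\<close>
  where \<open>I\<close> does not.\<close>

lemma matroid_thag:
  assumes S: "finite S"
  shows "matroid (thag S)"
  unfolding matroid_def
proof (intro conjI allI impI)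
  show "finite (ground (thag S))" using S by simp
  show "indep (thag S) {}" by (simp add: indep_thag_iff doubles_def)
  show "I \<subseteq> ground (thag S)" if "indep (thag S) I" for I using that by (simp add: indep_thag_iff)
  show "indep (thag S) I" if "indep (thag S) J" "I \<subseteq> J" for I J
  proof -
    have "doubles I \<subseteq> doubles J" using that(2) by (auto simp: doubles_def)
    then show ?thesis using that unfolding indep_thag_iff by blast
  qed
next
  fix I J assume I: "indep (thag S) I" and J: "indep (thag S) J" and less: "card I < card J"
  have IS: "I \<subseteq> thag_edges S" and JS: "J \<subseteq> thag_edges S" using I J by (auto simp: indep_thag_iff)
  show "\<exists>x\<in>J - I. indep (thag S) (insert x I)"
  proof (cases "ends J \<subseteq> ends I")
    case False
    then obtain j where j: "j \<in> ends J" "spokeA j \<notin> I" "spokeB j \<notin> I" by (auto simp: ends_def)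
    then have "j \<in> S" using ends_subset[OF JS] by auto
    moreover have "spokeA j \<in> J \<or> spokeB j \<in> J" using j(1) by (simp add: ends_def)
    \<comment> \<open>At a label untouched by \<open>I\<close>, either spoke can be added without
      producing a double.\<close>
    moreover have "indep (thag S) (insert (spokeA j) I)" "indep (thag S) (insert (spokeB j) I)"
      using \<open>j \<in> S\<close> j(2,3) I unfolding indep_thag_iff by auto
    ultimately show ?thesis using j(2,3) by blast
  next
    case True
    have "card (ends J) \<le> card (ends I)"
      using True ends_subset[OF IS] S by (meson card_mono finite_subset)
    then have "closes I < closes J"
      using less card_indep_thag[OF S I] card_indep_thag[OF S J] by simp
    then have c: "hub \<notin> I" "doubles I = {}" "hub \<in> J \<or> doubles J \<noteq> {}"
      by (auto simp: closes_def split: if_splits)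
    from c(3) show ?thesis
    proof
      assume "hub \<in> J"
      then show ?thesis using c I unfolding indep_thag_iff by (intro bexI[of _ hub]) auto
    next
      assume "doubles J \<noteq> {}"
      then obtain j where j: "spokeA j \<in> J" "spokeB j \<in> J" by (auto simp: doubles_def)
      then have jS: "j \<in> S" using JS by auto
      show ?thesis
      proof (cases "spokeA j \<in> I")
        case True
        then have "spokeB j \<notin> I" using c(2) by (auto simp: doubles_def)
        then show ?thesis using j jS c I unfolding indep_thag_iff by (intro bexI[of _ "spokeB j"]) auto
      next
        case False
        then show ?thesis using j jS c I unfolding indep_thag_iff by (intro bexI[of _ "spokeA j"]) auto
      qed
    qed
  qed
qed

text \<open>Monotonicity of \<open>ends\<close> and \<open>closes\<close> bounds the independent
  subsets. The bound is attained by one spoke at each touched label, with \<open>hub\<close> or one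
  second spoke added if \<open>X\<close> connects \<open>A\<close> and \<open>B\<close>.\<close>

lemma rk_thag:
  assumes S: "finite S" and X: "X \<subseteq> thag_edges S"
  shows "rk (thag S) X = card (ends X) + closes X"
proof -
  let ?M = "thag S"
  have M: "matroid ?M" by (rule matroid_thag[OF S])
  have fin: "finite (ends X)" using ends_subset[OF X] S by (rule finite_subset)
  obtain I where I: "I \<subseteq> X" "indep ?M I" "card I = rk ?M X" using ex_indep_card_rk[OF M] .
  have "ends I \<subseteq> ends X" "doubles I \<subseteq> doubles X" using I(1) by (auto simp: ends_def doubles_def)
  then have "card (ends I) \<le> card (ends X)" "closes I \<le> closes X"
    using fin I(1) by (auto simp: closes_def intro: card_mono)
  then have le: "rk ?M X \<le> card (ends X) + closes X"
    using card_indep_thag[OF S I(2)] I(3) by simp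
  \<comment> \<open>The spoke at \<open>A\<close> is preferred, so at a double the missing one is
    \<open>spokeB j\<close>, which the last case adds.\<close>
  define J where "J = (\<lambda>j. if spokeA j \<in> X then spokeA j else spokeB j) ` ends X"
  have JX: "J \<subseteq> X" by (auto simp: J_def ends_def)
  have Jmem: "hub \<notin> J" "spokeA j \<in> J \<longleftrightarrow> spokeA j \<in> X" "spokeB j \<in> J \<longleftrightarrow> spokeB j \<in> X \<and> spokeA j \<notin> X" for j
    by (auto simp: J_def ends_def)
  have Jd: "doubles J = {}" and Je: "ends J = ends X" by (auto simp: doubles_def ends_def Jmem)
  have iJ: "indep ?M J" unfolding indep_thag_iff using JX X Jd by auto
  have ge: "card (ends K) + closes K \<le> rk ?M X" if "K \<subseteq> X" "indep ?M K" for K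
    using card_le_rk[OF M that] card_indep_thag[OF S that(2)] by simp
  consider "closes X = 0" | "hub \<in> X" "closes X = 1" | j where "j \<in> doubles X" "closes X = 1"
    by (cases "hub \<in> X"; cases "doubles X = {}") (auto simp: closes_def)
  then have "card (ends X) + closes X \<le> rk ?M X"
  proof cases
    case 1
    then show ?thesis using ge[OF JX iJ] Je by simp
  next
    case 2
    then have "indep ?M (insert hub J)" unfolding indep_thag_iff using JX X Jd by auto
    then show ?thesis using ge[of "insert hub J"] 2 JX by (auto simp: Je closes_def)
  next
    case 3
    then have j: "spokeA j \<in> X" "spokeB j \<in> X" by (auto simp: doubles_def)
    then have jS: "j \<in> S" using X by auto
    have "indep ?M (insert (spokeB j) J)"
      unfolding indep_thag_iff using JX X Jd j jS by (auto simp: Jmem)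
    moreover have "closes (insert (spokeB j) J) = 1" using j by (simp add: closes_def Jmem)
    moreover have "j \<in> ends X" using j by (simp add: ends_def)
    then have "ends (insert (spokeB j) J) = ends X" by (simp add: Je insert_absorb)
    ultimately show ?thesis using ge[of "insert (spokeB j) J"] 3 JX j by simp
  qed
  then show ?thesis using le by simp
qed

text \<open>The flats without the edge \<open>AB\<close>.\<close>

definition partial_sections :: "nat set \<Rightarrow> vertex set set set" where
  "partial_sections S = {X. X \<subseteq> thag_edges S \<and> hub \<notin> X \<and> doubles X = {}}"

section \<open>The lattice of flats\<close>

lemma ends_thag_edges [simp]: "ends (thag_edges S) = S"
  by (auto simp: ends_def)

lemma rk_thag_edges:
  assumes "finite S" "A \<subseteq> S"
  shows "rk (thag S) (thag_edges A) = Suc (card A)"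
  using assms by (subst rk_thag) (auto simp: closes_def)

lemma card_ends_partial_section:
  assumes "finite S" "X \<in> partial_sections S"
  shows "card (ends X) = card X"
  using assms card_edges[of S X] by (simp add: partial_sections_def)

lemma rk_partial_section:
  assumes "finite S" "X \<in> partial_sections S"
  shows "rk (thag S) X = card X"
  using assms rk_thag[of S X] card_edges[of S X] by (simp add: partial_sections_def closes_def)

text \<open>Once \<open>A\<close> and \<open>B\<close> are connected, \<open>closes\<close> has its
  maximum 1, so \<open>hub\<close> and second spokes at touched labels do not raise the rank, and a
  flat must contain them.\<close>

lemma flats_thag:
  assumes S: "finite S"
  shows "flats (thag S) = thag_edges ` Pow S \<union> partial_sections S"
proof (intro equalityI subsetI)
  fix F assume "F \<in> flats (thag S)"
  then have F: "F \<subseteq> thag_edges S"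
    and inc: "\<And>e. e \<in> thag_edges S - F \<Longrightarrow> rk (thag S) F < rk (thag S) (insert e F)"
    by (auto simp: flats_def)
  have inc': "card (ends F) + closes F < card (ends (insert e F)) + closes (insert e F)"
    if "e \<in> thag_edges S" "e \<notin> F" for e
    using inc[of e] that rk_thag[OF S F] rk_thag[OF S, of "insert e F"] F by simp
  show "F \<in> thag_edges ` Pow S \<union> partial_sections S"
  proof (cases "hub \<in> F \<or> doubles F \<noteq> {}")
    case False
    then show ?thesis using F by (simp add: partial_sections_def)
  next
    case True
    then have c: "closes F = 1" by (simp add: closes_def)
    have le: "closes X \<le> 1" for X by (simp add: closes_def)
    have "hub \<in> F" using inc'[of hub] c le[of "insert hub F"] by auto
    moreover have "spokeA j \<in> F" "spokeB j \<in> F" if "j \<in> ends F" for j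
    proof -
      have "j \<in> S" using that ends_subset[OF F] by auto
      moreover have "insert j (ends F) = ends F" using that by auto
      ultimately show "spokeA j \<in> F" "spokeB j \<in> F"
        using inc'[of "spokeA j"] inc'[of "spokeB j"] c le[of "insert (spokeA j) F"] le[of "insert (spokeB j) F"]
        by auto
    qed
    ultimately have "thag_edges (ends F) \<subseteq> F" by (auto simp: thag_edges_def)
    moreover have "F \<subseteq> thag_edges (ends F)" using F by (auto simp: ends_def elim!: thag_edgesE)
    ultimately have "F = thag_edges (ends F)" by auto
    then show ?thesis using ends_subset[OF F] by blast
  qed
next
  fix F assume F: "F \<in> thag_edges ` Pow S \<union> partial_sections S"
  then have FE: "F \<subseteq> thag_edges S" by (auto simp: thag_edges_def partial_sections_def)
  have fin: "finite (ends F)" using ends_subset[OF FE] S by (rule finite_subset)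
  have "card (ends F) + closes F < card (ends (insert e F)) + closes (insert e F)"
    if e: "e \<in> thag_edges S" "e \<notin> F" for e
    using F
  proof
    assume "F \<in> thag_edges ` Pow S"
    then obtain A where A: "F = thag_edges A" by auto
    have "closes F = 1" "closes (insert e F) = 1" by (simp_all add: closes_def A)
    \<comment> \<open>\<open>closes\<close> cannot grow, but every missing edge is a spoke at a new
      label.\<close>
    then show ?thesis using e fin unfolding A by (elim thag_edgesE) auto
  next
    assume "F \<in> partial_sections S"
    then have ps: "hub \<notin> F" "doubles F = {}" by (auto simp: partial_sections_def)
    \<comment> \<open>A spoke at a new label raises \<open>card (ends F)\<close>; a second spoke at
      a touched label raises \<open>closes\<close> from 0 to 1.\<close>
    have sp: "card (ends F) < card (insert j (ends F)) + (if j \<in> ends F then 1 else 0)" for j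
      using fin by (auto simp: insert_absorb)
    from e show ?thesis
    proof (elim thag_edgesE)
      fix j assume "e = spokeA j"
      moreover from this have "j \<in> ends F \<longleftrightarrow> spokeB j \<in> F" using e by (simp add: ends_def)
      ultimately show ?thesis using sp[of j] ps by (auto simp: closes_def)
    next
      fix j assume "e = spokeB j"
      moreover from this have "j \<in> ends F \<longleftrightarrow> spokeA j \<in> F" using e by (simp add: ends_def)
      ultimately show ?thesis using sp[of j] ps by (auto simp: closes_def)
    qed (use ps in \<open>auto simp: closes_def\<close>)
  qed
  then show "F \<in> flats (thag S)"
    unfolding flats_def using FE rk_thag[OF S FE] rk_thag[OF S, of "insert _ F"] by simp
qed

section \<open>Binomial sums over intervals of flats\<close>

lemma sum_Pow_card:
  fixes f :: "nat \<Rightarrow> 'b::comm_ring_1"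
  assumes "finite S"
  shows "(\<Sum>A\<in>Pow S. f (card A)) = (\<Sum>k\<le>card S. of_nat (card S choose k) * f k)"
proof -
  have "(\<Sum>A\<in>Pow S. f (card A)) = (\<Sum>k\<le>card S. \<Sum>A\<in>{A \<in> Pow S. card A = k}. f (card A))"
    using assms by (intro sum.group[symmetric]) (auto intro: card_mono)
  also have "\<dots> = (\<Sum>k\<le>card S. of_nat (card S choose k) * f k)"
    using n_subsets[OF assms] by (intro sum.cong refl) (simp add: Pow_def)
  finally show ?thesis .
qed

text \<open>The binomial theorem on a Boolean interval. Integers for \<open>x\<close> give Moebius
  sums, multiples of \<open>t\<close> give reversed characteristic polynomials.\<close>

lemma sum_interval_power:
  fixes x :: "'b::comm_ring_1"
  assumes "finite S" "A \<subseteq> S"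
  shows "(\<Sum>B\<in>{B. A \<subseteq> B \<and> B \<subseteq> S}. x ^ (card B - card A)) = (1 + x) ^ (card S - card A)"
proof -
  have fin: "finite A" using assms by (auto intro: finite_subset)
  have "(\<Sum>B\<in>{B. A \<subseteq> B \<and> B \<subseteq> S}. x ^ (card B - card A)) = (\<Sum>C\<in>Pow (S - A). x ^ card C)"
    by (rule sum.reindex_bij_witness[where i = "\<lambda>C. A \<union> C" and j = "\<lambda>B. B - A"])
       (use assms fin in \<open>auto simp: card_Diff_subset\<close>)
  also have "\<dots> = (\<Sum>k\<le>card (S - A). of_nat (card (S - A) choose k) * x ^ k * 1 ^ (card (S - A) - k))"
    using assms by (subst sum_Pow_card) auto
  also have "\<dots> = (1 + x) ^ (card S - card A)"
    unfolding binomial_ring[symmetric] using assms fin by (simp add: card_Diff_subset add.commute)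
  finally show ?thesis .
qed

lemma partial_sections_empty [simp]: "partial_sections {} = {{}}"
  by (auto simp: partial_sections_def thag_edges_def doubles_def)

lemma finite_partial_sections: "finite S \<Longrightarrow> finite (partial_sections S)"
  by (rule finite_subset[of _ "Pow (thag_edges S)"]) (auto simp: partial_sections_def)

lemma partial_sections_insert:
  assumes j: "j \<notin> S"
  shows "partial_sections (insert j S) =
    partial_sections S \<union> (insert (spokeA j) ` partial_sections S \<union> insert (spokeB j) ` partial_sections S)"
    (is "?L = ?R")
proof (intro equalityI subsetI)
  fix X assume "X \<in> ?L"
  then have X: "X \<subseteq> thag_edges (insert j S)" "hub \<notin> X" "doubles X = {}"
    by (auto simp: partial_sections_def)
  define Y where "Y = X - {spokeA j, spokeB j}"
  have "Y \<subseteq> thag_edges S" using X(1,2) by (auto simp: Y_def thag_edges_def)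
  then have Y: "Y \<in> partial_sections S"
    using X by (auto simp: partial_sections_def Y_def doubles_def)
  have "\<not> (spokeA j \<in> X \<and> spokeB j \<in> X)" using X(3) by (auto simp: doubles_def)
  then consider "X = Y" | "X = insert (spokeA j) Y" | "X = insert (spokeB j) Y"
    unfolding Y_def by blast
  then show "X \<in> ?R" using Y by cases auto
next
  fix X assume "X \<in> ?R"
  then obtain Y where Y: "Y \<in> partial_sections S" "X = Y \<or> X = insert (spokeA j) Y \<or> X = insert (spokeB j) Y"
    by auto
  have sub: "Y \<subseteq> thag_edges S" "hub \<notin> Y" "doubles Y = {}" using Y(1) by (auto simp: partial_sections_def)
  have nin: "spokeA j \<notin> Y" "spokeB j \<notin> Y" using sub(1) j by auto
  have "thag_edges S \<subseteq> thag_edges (insert j S)" by auto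
  then have "Y \<subseteq> thag_edges (insert j S)" using sub(1) by blast
  then show "X \<in> ?L" using Y(2) sub nin by (auto simp: partial_sections_def)
qed

lemma card_partial_section_le:
  assumes "finite S" "X \<in> partial_sections S"
  shows "card X \<le> card S"
proof -
  have "ends X \<subseteq> S" using assms(2) ends_subset by (auto simp: partial_sections_def)
  then show ?thesis using card_ends_partial_section[OF assms] assms(1) card_mono by metis
qed

text \<open>The labels contribute independently: no spoke with weight \<open>y\<close>, or one of
  two spokes with weight \<open>x\<close> each.\<close>

lemma sum_partial_sections_power:
  fixes x y :: "'b::comm_ring_1"
  assumes "finite S"
  shows "(\<Sum>X\<in>partial_sections S. x ^ card X * y ^ (card S - card X)) = (2 * x + y) ^ card S"
  using assms
proof (induction S)
  case (insert j S)
  let ?P = "partial_sections S"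
  have nin: "spokeA j \<notin> X" "spokeB j \<notin> X" "finite X" "card X \<le> card S" if "X \<in> ?P" for X
  proof -
    have "X \<subseteq> thag_edges S" using that by (simp add: partial_sections_def)
    then show "spokeA j \<notin> X" "spokeB j \<notin> X" "finite X"
      using insert.hyps by (auto intro: finite_subset[of _ "thag_edges S"])
    show "card X \<le> card S" using card_partial_section_le[OF insert.hyps(1) that] .
  qed
  let ?f = "\<lambda>X. x ^ card X * y ^ (Suc (card S) - card X)"
  have fin: "finite ?P" by (rule finite_partial_sections[OF insert.hyps(1)])
  have ins: "(\<Sum>X\<in>insert e ` ?P. ?f X) = x * (\<Sum>X\<in>?P. x ^ card X * y ^ (card S - card X))"
    if "\<And>X. X \<in> ?P \<Longrightarrow> e \<notin> X" for e
  proof -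
    have "inj_on (insert e) ?P" using that by (intro inj_onI) (simp add: insert_ident)
    then have "(\<Sum>X\<in>insert e ` ?P. ?f X) = (\<Sum>X\<in>?P. ?f (insert e X))" by (simp add: sum.reindex)
    also have "\<dots> = x * (\<Sum>X\<in>?P. x ^ card X * y ^ (card S - card X))"
      unfolding sum_distrib_left using that nin by (intro sum.cong refl) (simp add: mult.assoc)
    finally show ?thesis .
  qed
  \<comment> \<open>\<open>card X \<le> card S\<close> lets a factor \<open>y\<close> split off
    without truncation in the exponent.\<close>
  have keep: "(\<Sum>X\<in>?P. ?f X) = y * (\<Sum>X\<in>?P. x ^ card X * y ^ (card S - card X))"
    unfolding sum_distrib_left using nin by (intro sum.cong refl) (simp add: Suc_diff_le mult_ac)
  have disj: "?P \<inter> (insert (spokeA j) ` ?P \<union> insert (spokeB j) ` ?P) = {}"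
    "insert (spokeA j) ` ?P \<inter> insert (spokeB j) ` ?P = {}"
    using nin by (force, auto) (metis edge_eq_iff(3) insertE insertI1 nin(1))
  have "(\<Sum>X\<in>partial_sections (insert j S). ?f X) =
      (\<Sum>X\<in>?P. ?f X) + ((\<Sum>X\<in>insert (spokeA j) ` ?P. ?f X) + (\<Sum>X\<in>insert (spokeB j) ` ?P. ?f X))"
    unfolding partial_sections_insert[OF insert.hyps(2)]
    using fin by (simp only: sum.union_disjoint[OF _ _ disj(1)] sum.union_disjoint[OF _ _ disj(2)] finite_imageI finite_UnI)
  also have "\<dots> = (2 * x + y) * (2 * x + y) ^ card S"
    using nin by (simp add: ins keep insert.IH algebra_simps)
  finally show ?case using insert.hyps by simp
qed simp

text \<open>Above \<open>F\<close> lie the unions of \<open>F\<close> with partial sections on the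
  labels outside \<open>ends F\<close>, since a second spoke at a label of \<open>F\<close> would be
  a double.\<close>

lemma sum_partial_sections_above:
  fixes x :: "'b::comm_ring_1"
  assumes S: "finite S" and F: "F \<in> partial_sections S"
  shows "(\<Sum>X\<in>{X \<in> partial_sections S. F \<subseteq> X}. x ^ (card X - card F)) = (1 + 2 * x) ^ (card S - card F)"
proof -
  have F': "F \<subseteq> thag_edges S" "hub \<notin> F" "doubles F = {}" using F by (auto simp: partial_sections_def)
  have finF: "finite F" using F'(1) S by (meson finite_subset finite_thag_edges)
  have eF: "ends F \<subseteq> S" "finite (ends F)" using ends_subset[OF F'(1)] S by (auto intro: finite_subset)
  have diff: "X - F \<in> partial_sections (S - ends F)" if X: "X \<in> partial_sections S" "F \<subseteq> X" for X
  proof -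
    have X': "X \<subseteq> thag_edges S" "hub \<notin> X" "doubles X = {}" using X by (auto simp: partial_sections_def)
    have "e \<in> thag_edges (S - ends F)" if e: "e \<in> X - F" for e
    proof -
      have "e \<in> thag_edges S" using e X'(1) by blast
      then show ?thesis
        by (rule thag_edgesE) (use e X'(2,3) X(2) in \<open>auto simp: ends_def doubles_def\<close>)
    qed
    then show ?thesis using X' by (auto simp: partial_sections_def doubles_def)
  qed
  have union: "F \<union> H \<in> partial_sections S" "F \<inter> H = {}" if H: "H \<in> partial_sections (S - ends F)" for H
  proof -
    have H': "H \<subseteq> thag_edges (S - ends F)" "hub \<notin> H" "doubles H = {}" using H by (auto simp: partial_sections_def)
    have "H \<subseteq> thag_edges S" using H'(1) thag_edges_subset_iff[of "S - ends F" S] by blast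
    moreover have eH: "ends H \<inter> ends F = {}" using ends_subset[OF H'(1)] by auto
    moreover have "doubles (F \<union> H) = {}"
      using eH F'(3) H'(3) unfolding doubles_def ends_def by blast
    ultimately show "F \<union> H \<in> partial_sections S" using F' H' by (auto simp: partial_sections_def)
    show "F \<inter> H = {}"
    proof (rule ccontr)
      assume "F \<inter> H \<noteq> {}"
      then obtain e where e: "e \<in> F" "e \<in> H" by blast
      then have "e \<in> thag_edges S" using F' by blast
      then show False
        by (rule thag_edgesE) (use e F'(2) eH in \<open>auto simp: ends_def\<close>)
    qed
  qed
  have "(\<Sum>X\<in>{X \<in> partial_sections S. F \<subseteq> X}. x ^ (card X - card F)) =
      (\<Sum>H\<in>partial_sections (S - ends F). x ^ card H)"
    by (rule sum.reindex_bij_witness[where i = "\<lambda>H. F \<union> H" and j = "\<lambda>X. X - F"])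
       (use diff union finF in \<open>auto simp: card_Diff_subset\<close>)
  also have "\<dots> = (2 * x + 1) ^ card (S - ends F)"
    using sum_partial_sections_power[of "S - ends F" x 1] S by simp
  also have "card (S - ends F) = card S - card F"
    using eF card_ends_partial_section[OF S F] by (simp add: card_Diff_subset)
  finally show ?thesis by (simp add: add.commute)
qed

section \<open>Moebius values and reversed characteristic polynomials for
  \<open>thag S\<close>\<close>

lemma inj_thag_edges: "inj_on thag_edges A"
  by (rule inj_on_inverseI[of _ ends]) simp

lemma hub_notin_partial_section: "X \<in> partial_sections S \<Longrightarrow> hub \<notin> X"
  by (simp add: partial_sections_def)

lemma thag_edges_not_subset_partial_section: "X \<in> partial_sections S \<Longrightarrow> \<not> thag_edges A \<subseteq> X"
  using hub_notin_partial_section thag_edges_iff(1) by blast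

lemma sum_flats_thag:
  assumes "finite S"
  shows "(\<Sum>F\<in>{F \<in> flats (thag S). P F}. f F) =
    (\<Sum>A\<in>{A \<in> Pow S. P (thag_edges A)}. f (thag_edges A)) + (\<Sum>F\<in>{F \<in> partial_sections S. P F}. f F)"
proof -
  have "{F \<in> flats (thag S). P F} =
      thag_edges ` {A \<in> Pow S. P (thag_edges A)} \<union> {F \<in> partial_sections S. P F}"
    unfolding flats_thag[OF assms] by auto
  moreover have "thag_edges ` {A \<in> Pow S. P (thag_edges A)} \<inter> {F \<in> partial_sections S. P F} = {}"
    using hub_notin_partial_section by fastforce
  ultimately show ?thesis
    using assms finite_partial_sections[OF assms]
    by (simp add: sum.union_disjoint sum.reindex[OF inj_thag_edges])
qed

lemma partial_section_subset_iff:
  "X \<in> partial_sections S \<Longrightarrow> X \<subseteq> thag_edges B \<longleftrightarrow> ends X \<subseteq> B"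
proof (intro iffI subsetI)
  fix e assume X: "X \<in> partial_sections S" "ends X \<subseteq> B" and e: "e \<in> X"
  then have "e \<in> thag_edges S" "e \<noteq> hub" by (auto simp: partial_sections_def)
  then show "e \<in> thag_edges B"
    by (elim thag_edgesE) (use X(2) e in \<open>auto simp: ends_def\<close>)
qed (use ends_subset in blast)

text \<open>Flats above \<open>thag_edges A\<close> contain \<open>hub\<close>, hence have the form
  \<open>thag_edges C\<close>, and the interval is Boolean.\<close>

lemma mobius_thag_edges:
  assumes S: "finite S" and AB: "A \<subseteq> B" "B \<subseteq> S"
  shows "mobius (flats (thag S)) (thag_edges A) (thag_edges B) = (-1) ^ (card B - card A)"
proof -
  let ?L = "flats (thag S)"
  let ?m = "\<lambda>G. (-1) ^ (card (ends G) - card A) :: int"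
  have "mobius ?L (thag_edges A) (thag_edges B) = ?m (thag_edges B)"
  proof (rule mobius_eqI)
    show "finite ?L" using S by (intro finite_flats) simp
    show "finite Y" if "Y \<in> ?L" for Y
      using that S by (auto simp: flats_def intro: finite_subset[of _ "thag_edges S"])
    show "thag_edges A \<in> ?L" "thag_edges B \<in> ?L" using AB by (auto simp: flats_thag[OF S])
    show "(\<Sum>Z\<in>{Z \<in> ?L. thag_edges A \<subseteq> Z \<and> Z \<subseteq> Y}. ?m Z) = 0" if Y: "Y \<in> ?L" "thag_edges A \<subset> Y" for Y
    proof -
      obtain C where C: "Y = thag_edges C" "C \<subseteq> S"
        using Y thag_edges_not_subset_partial_section by (auto simp: flats_thag[OF S])
      have AC: "A \<subset> C" using Y(2) unfolding C(1) psubset_eq by auto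
      have "(\<Sum>Z\<in>{Z \<in> ?L. thag_edges A \<subseteq> Z \<and> Z \<subseteq> Y}. ?m Z) =
          (\<Sum>D\<in>{D \<in> Pow S. A \<subseteq> D \<and> D \<subseteq> C}. (-1) ^ (card D - card A)) +
          (\<Sum>Z\<in>{Z \<in> partial_sections S. thag_edges A \<subseteq> Z \<and> Z \<subseteq> Y}. ?m Z)"
        by (simp add: sum_flats_thag[OF S] C(1))
      also have "{Z \<in> partial_sections S. thag_edges A \<subseteq> Z \<and> Z \<subseteq> Y} = {}" 
        using thag_edges_not_subset_partial_section by blast
      also have "{D \<in> Pow S. A \<subseteq> D \<and> D \<subseteq> C} = {D. A \<subseteq> D \<and> D \<subseteq> C}" using C(2) by blast
      also have "(\<Sum>D\<in>{D. A \<subseteq> D \<and> D \<subseteq> C}. (-1) ^ (card D - card A)) = (1 + (-1) :: int) ^ (card C - card A)"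
        using AC C(2) S by (intro sum_interval_power) (auto intro: finite_subset)
      finally show ?thesis
        using psubset_card_mono[OF finite_subset[OF C(2) S] AC] by (simp add: power_0_left)
    qed
  qed (use AB in auto)
  then show ?thesis by simp
qed

text \<open>For \<open>m = card (ends G) - card F\<close>, the first value is the constant term of the
  characteristic polynomial \<open>(t-1) (t-2)\<^bsup>m\<^esup>\<close> of \<open>T\<^sub>m\<close>.\<close>

lemma mobius_partial_section:
  assumes S: "finite S" and F: "F \<in> partial_sections S" and G: "G \<in> flats (thag S)" "F \<subseteq> G"
  shows "mobius (flats (thag S)) F G =
    (if hub \<in> G then - ((-2) ^ (card (ends G) - card F)) else (-1) ^ (card G - card F))"
    (is "_ = ?m G")
proof (rule mobius_eqI[OF _ _ _ _ _ G])
  let ?L = "flats (thag S)"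
  have fin: "finite Y" if "Y \<in> ?L" for Y
    using that S by (auto simp: flats_def intro: finite_subset[of _ "thag_edges S"])
  show "finite Y" if "Y \<in> ?L" for Y by (rule fin[OF that])
  show "finite ?L" using S by (intro finite_flats) simp
  show FL: "F \<in> ?L" using F by (simp add: flats_thag[OF S])
  show "?m F = 1" using F by (simp add: partial_sections_def)
  fix Y assume Y: "Y \<in> ?L" "F \<subset> Y"
  from Y(1) consider C where "Y = thag_edges C" "C \<subseteq> S" | "Y \<in> partial_sections S"
    by (auto simp: flats_thag[OF S])
  then show "(\<Sum>Z\<in>{Z \<in> ?L. F \<subseteq> Z \<and> Z \<subseteq> Y}. ?m Z) = 0"
  proof cases
    case 1
    have finC: "finite C" using 1(2) S by (rule finite_subset)
    have eF: "ends F \<subseteq> C" using Y(2) 1(1) partial_section_subset_iff[OF F, of C] by auto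
    have FC: "F \<in> partial_sections C" using F Y(2) 1(1) by (auto simp: partial_sections_def)
    have "thag_edges C \<subseteq> thag_edges S" using 1(2) by simp
    then have set1: "{Z \<in> partial_sections S. F \<subseteq> Z \<and> Z \<subseteq> Y} = {Z \<in> partial_sections C. F \<subseteq> Z}"
      unfolding 1(1) partial_sections_def by blast
    have set2: "{D \<in> Pow S. F \<subseteq> thag_edges D \<and> thag_edges D \<subseteq> Y} = {D. ends F \<subseteq> D \<and> D \<subseteq> C}"
      using 1 partial_section_subset_iff[OF F] by auto
    \<comment> \<open>With \<open>m = card C - card F\<close>, the flats containing
      \<open>hub\<close> contribute \<open>- ((1 - 2) ^ m)\<close> and the others
      \<open>(1 - 2) ^ m\<close>.\<close>
    have "(\<Sum>Z\<in>{Z \<in> ?L. F \<subseteq> Z \<and> Z \<subseteq> Y}. ?m Z) =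
       (\<Sum>D\<in>{D. ends F \<subseteq> D \<and> D \<subseteq> C}. ?m (thag_edges D)) + (\<Sum>Z\<in>{Z \<in> partial_sections C. F \<subseteq> Z}. ?m Z)"
      unfolding sum_flats_thag[OF S] set1 set2 ..
    also have "(\<Sum>Z\<in>{Z \<in> partial_sections C. F \<subseteq> Z}. ?m Z) =
        (\<Sum>Z\<in>{Z \<in> partial_sections C. F \<subseteq> Z}. (-1) ^ (card Z - card F))"
      by (intro sum.cong refl) (auto simp: partial_sections_def)
    also have "\<dots> = (1 + 2 * (-1)) ^ (card C - card F)" by (rule sum_partial_sections_above[OF finC FC])
    also have "(\<Sum>D\<in>{D. ends F \<subseteq> D \<and> D \<subseteq> C}. ?m (thag_edges D)) =
        - (\<Sum>D\<in>{D. ends F \<subseteq> D \<and> D \<subseteq> C}. (-2) ^ (card D - card (ends F)))"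
      by (simp add: sum_negf card_ends_partial_section[OF S F])
    also have "\<dots> = - ((1 + (-2)) ^ (card C - card F))"
      unfolding sum_interval_power[OF finC eF] unfolding card_ends_partial_section[OF S F] ..
    finally show ?thesis by simp
  next
    case 2
    \<comment> \<open>Subsets of a partial section are partial sections, so this interval is
      Boolean.\<close>
    have "Z \<in> partial_sections S" if "Z \<subseteq> Y" for Z
      using that 2 unfolding partial_sections_def doubles_def by blast
    then have set: "{Z \<in> ?L. F \<subseteq> Z \<and> Z \<subseteq> Y} = {Z. F \<subseteq> Z \<and> Z \<subseteq> Y}" by (auto simp: flats_thag[OF S])
    have finY: "finite Y" by (rule fin[OF Y(1)])
    have "(\<Sum>Z\<in>{Z \<in> ?L. F \<subseteq> Z \<and> Z \<subseteq> Y}. ?m Z) = (\<Sum>Z\<in>{Z. F \<subseteq> Z \<and> Z \<subseteq> Y}. (-1) ^ (card Z - card F))"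
      unfolding set using hub_notin_partial_section[OF 2] by (intro sum.cong refl) auto
    also have "\<dots> = (1 + (-1)) ^ (card Y - card F)"
      using Y(2) by (intro sum_interval_power finY) auto
    finally show ?thesis using psubset_card_mono[OF finY Y(2)] by (simp add: power_0_left)
  qed
qed

lemma monom_power_eq: "monom (c ^ k) k = [:0, c:] ^ k" for c :: int
  using monom_power[of c 1 k] by (simp add: monom_Suc monom_0)

lemma rev_char_poly_thag_edges:
  assumes S: "finite S" and A: "A \<subseteq> S"
  shows "(\<Sum>G\<in>{G \<in> flats (thag S). thag_edges A \<subseteq> G}. monom (mobius (flats (thag S)) (thag_edges A) G)
      (rk (thag S) G - rk (thag S) (thag_edges A))) = [:1, -1:] ^ (card S - card A)"
proof -
  let ?f = "\<lambda>G. monom (mobius (flats (thag S)) (thag_edges A) G) (rk (thag S) G - rk (thag S) (thag_edges A))"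
  have hub: "{F \<in> partial_sections S. thag_edges A \<subseteq> F} = {}"
    using thag_edges_not_subset_partial_section by blast
  have "(\<Sum>G\<in>{G \<in> flats (thag S). thag_edges A \<subseteq> G}. ?f G) = (\<Sum>B\<in>{B \<in> Pow S. A \<subseteq> B}. ?f (thag_edges B))"
    unfolding sum_flats_thag[OF S] hub by simp
  also have "\<dots> = (\<Sum>B\<in>{B. A \<subseteq> B \<and> B \<subseteq> S}. [:0, -1:] ^ (card B - card A))"
    by (rule sum.cong) (auto simp: mobius_thag_edges[OF S] rk_thag_edges[OF S] A monom_power_eq)
  also have "\<dots> = (1 + [:0, -1:]) ^ (card S - card A)" by (rule sum_interval_power[OF S A])
  finally show ?thesis by (simp add: one_pCons)
qed

text \<open>For \<open>m = card S - card F\<close> this is the reversal of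
  \<open>(t - 1) (t - 2)^m\<close>. The flats containing \<open>hub\<close> give
  \<open>- t (1 - 2 t)^m\<close>, the others \<open>(1 - 2 t)^m\<close>.\<close>

lemma rev_char_poly_partial_section:
  assumes S: "finite S" and F: "F \<in> partial_sections S"
  shows "(\<Sum>G\<in>{G \<in> flats (thag S). F \<subseteq> G}. monom (mobius (flats (thag S)) F G)
      (rk (thag S) G - rk (thag S) F)) = [:1, -1:] * [:1, -2:] ^ (card S - card F)"
proof -
  let ?f = "\<lambda>G. monom (mobius (flats (thag S)) F G) (rk (thag S) G - rk (thag S) F)"
  have eF: "ends F \<subseteq> S" using F ends_subset by (simp add: partial_sections_def)
  have cF: "card (ends F) = card F" by (rule card_ends_partial_section[OF S F])
  have 1: "?f (thag_edges B) = - [:0, 1:] * [:0, -2:] ^ (card B - card (ends F))" if B: "ends F \<subseteq> B" "B \<subseteq> S" for B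
  proof -
    have "card F \<le> card B" using card_mono[OF finite_subset[OF B(2) S] B(1)] cF by simp
    \<comment> \<open>Connecting \<open>A\<close> and \<open>B\<close> costs one more rank, the
      source of the factor \<open>t\<close>.\<close>
    then have "rk (thag S) (thag_edges B) - rk (thag S) F = Suc (card B - card F)"
      by (simp add: rk_thag_edges[OF S B(2)] rk_partial_section[OF S F])
    moreover have "mobius (flats (thag S)) F (thag_edges B) = - ((-2) ^ (card B - card F))"
      using mobius_partial_section[OF S F, of "thag_edges B"] B partial_section_subset_iff[OF F, of B]
      by (auto simp: flats_thag[OF S])
    ultimately have "?f (thag_edges B) = - monom 1 1 * monom ((-2) ^ (card B - card F)) (card B - card F)"
      by (simp add: mult_monom minus_monom)
    then show ?thesis by (simp add: monom_power_eq cF monom_Suc)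
  qed
  have 2: "?f G = [:0, -1:] ^ (card G - card F)" if "G \<in> partial_sections S" "F \<subseteq> G" for G
    using that mobius_partial_section[OF S F, of G]
    by (simp add: flats_thag[OF S] hub_notin_partial_section rk_partial_section[OF S] F monom_power_eq)
  have factor: "- p * r + r = (1 - p) * r" for p r :: "int poly" by (simp add: algebra_simps)
  have set: "{B \<in> Pow S. F \<subseteq> thag_edges B} = {B. ends F \<subseteq> B \<and> B \<subseteq> S}"
    using partial_section_subset_iff[OF F] by auto
  have "(\<Sum>G\<in>{G \<in> flats (thag S). F \<subseteq> G}. ?f G) =
      (\<Sum>B\<in>{B. ends F \<subseteq> B \<and> B \<subseteq> S}. - [:0, 1:] * [:0, -2:] ^ (card B - card (ends F))) +
      (\<Sum>G\<in>{G \<in> partial_sections S. F \<subseteq> G}. [:0, -1:] ^ (card G - card F))"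
    unfolding sum_flats_thag[OF S] set using 1 2 by (intro arg_cong2[where f = "(+)"] sum.cong refl) auto
  also have "\<dots> = - [:0, 1:] * (1 + [:0, -2:]) ^ (card S - card F) + (1 + 2 * [:0, -1:]) ^ (card S - card F)"
    unfolding sum_distrib_left[symmetric] sum_interval_power[OF S eF] sum_partial_sections_above[OF S F] unfolding cF ..
  also have "1 + 2 * [:0, -1:] = [:1, -2 :: int:]" by (simp add: one_pCons numeral_poly)
  also have "1 + [:0, -2:] = [:1, -2 :: int:]" by (simp add: one_pCons)
  also have "- [:0, 1:] * [:1, -2:] ^ (card S - card F) + [:1, -2:] ^ (card S - card F) =
      (1 - [:0, 1:]) * [:1, -2 :: int:] ^ (card S - card F)"
    by (rule factor)
  also have "1 - [:0, 1:] = [:1, -1 :: int:]" by (simp add: one_pCons)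
  finally show ?thesis .
qed

section \<open>Solving the defining identity\<close>

definition free_matroid :: "'a set \<Rightarrow> 'a matroid" where
  "free_matroid E = \<lparr>ground = E, indep = (\<lambda>I. I \<subseteq> E)\<rparr>"

lemma matroid_free_matroid:
  assumes "finite E"
  shows "matroid (free_matroid E)"
  unfolding matroid_def free_matroid_def
proof (simp add: assms, intro conjI allI impI)
  fix I J assume IJ: "I \<subseteq> E" "J \<subseteq> E" "card I < card J"
  then have "\<not> J \<subseteq> I" using card_mono[of I J] finite_subset[OF _ assms] by auto
  then show "\<exists>x\<in>J - I. x \<in> E" using IJ by blast
qed blast

lemma rk_free_matroid:
  assumes "finite E" "X \<subseteq> E"
  shows "rk (free_matroid E) X = card X"
proof -
  have "finite X" using assms by (auto intro: finite_subset)
  then show ?thesis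
    unfolding rk_def free_matroid_def using assms by (intro Max_eqI) (auto intro: card_mono)
qed

lemma flats_free_matroid:
  assumes "finite E"
  shows "flats (free_matroid E) = Pow E"
proof -
  have "rk (free_matroid E) F < rk (free_matroid E) (insert e F)" if "F \<subseteq> E" "e \<in> E - F" for e F
    using that assms finite_subset[OF that(1) assms] by (simp add: rk_free_matroid)
  then show ?thesis unfolding flats_def by (auto simp: free_matroid_def)
qed

text \<open>With \<open>n = card E\<close> and the value 1 on all flats, the right-hand side is the
  expansion of \<open>(-1 + (1 - t))^n = (-t)^n\<close>, the signed reversal of 1.\<close>

lemma inverse_KL_free_matroid:
  assumes "finite E"
  shows "inverse_KL (free_matroid E) = 1"
  using assms
proof (induction "card E" arbitrary: E rule: less_induct)
  case less
  let ?M = "free_matroid E"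
  have ground: "ground ?M = E" by (simp add: free_matroid_def)
  have r: "rank ?M = card E" using rk_free_matroid[OF less.prems] by (simp add: ground)
  show ?case
  proof (cases "E = {}")
    case True
    then have "rank ?M = 0" "finite (ground ?M)" using r ground by simp_all
    then show ?thesis by (simp add: inverse_KL.simps[of ?M])
  next
    case False
    then have pos: "0 < card E" using less.prems by (simp add: card_gt_0_iff)
    have IH: "inverse_KL (restriction ?M F) = 1" if "F \<subseteq> E" "F \<noteq> E" for F
    proof -
      have "restriction ?M F = free_matroid F"
        using that by (auto simp: restriction_def free_matroid_def)
      moreover have "card F < card E" using that less.prems by (intro psubset_card_mono) auto
      ultimately show ?thesis using less.hyps that less.prems by (simp add: finite_subset)
    qed
    have mob: "mobius (Pow E) F G = (-1) ^ (card G - card F)" if FG: "F \<subseteq> G" "G \<subseteq> E" for F G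
    proof (rule mobius_eqI[of "Pow E" F "\<lambda>G. (-1) ^ (card G - card F)"])
      fix Y assume Y: "Y \<in> Pow E" "F \<subset> Y"
      have finY: "finite Y" using Y less.prems by (auto intro: finite_subset)
      have "{Z \<in> Pow E. F \<subseteq> Z \<and> Z \<subseteq> Y} = {Z. F \<subseteq> Z \<and> Z \<subseteq> Y}" using Y by blast
      then have "(\<Sum>Z\<in>{Z \<in> Pow E. F \<subseteq> Z \<and> Z \<subseteq> Y}. (-1) ^ (card Z - card F)) = (1 + (-1) :: int) ^ (card Y - card F)"
        using sum_interval_power[OF finY psubset_imp_subset[OF Y(2)], of "-1 :: int"] by (simp only:)
      then show "(\<Sum>Z\<in>{Z \<in> Pow E. F \<subseteq> Z \<and> Z \<subseteq> Y}. (-1) ^ (card Z - card F) :: int) = 0"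
        using psubset_card_mono[OF finY Y(2)] by (simp add: power_0_left)
    qed (use FG less.prems in \<open>auto intro: finite_subset\<close>)
    have inner: "(\<Sum>G\<in>{G \<in> Pow E. F \<subseteq> G}. monom (mobius (Pow E) F G) (rk ?M G - rk ?M F)) =
        [:1, -1:] ^ (card E - card F)" if F: "F \<subseteq> E" for F
    proof -
      have "(\<Sum>G\<in>{G \<in> Pow E. F \<subseteq> G}. monom (mobius (Pow E) F G) (rk ?M G - rk ?M F)) =
          (\<Sum>G\<in>{G. F \<subseteq> G \<and> G \<subseteq> E}. [:0, -1:] ^ (card G - card F))"
        by (rule sum.cong) (auto simp: mob rk_free_matroid[OF less.prems] F monom_power_eq)
      also have "\<dots> = (1 + [:0, -1:]) ^ (card E - card F)" by (rule sum_interval_power[OF less.prems F])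
      finally show ?thesis by (simp add: one_pCons)
    qed
    show ?thesis
    proof (rule inverse_KL_eqI[OF matroid_free_matroid[OF less.prems]])
      show "0 < rank ?M" "2 * degree 1 < rank ?M" using pos r by simp_all
      have "(\<Sum>F\<in>flats ?M. smult ((-1) ^ rk ?M F) (if F = ground ?M then 1 else inverse_KL (restriction ?M F)) *
          (\<Sum>G\<in>{G \<in> flats ?M. F \<subseteq> G}. monom (mobius (flats ?M) F G) (rk ?M G - rk ?M F))) =
        (\<Sum>F\<in>Pow E. (-1) ^ card F * [:1, -1:] ^ (card E - card F))"
        unfolding flats_free_matroid[OF less.prems] ground
      proof (intro sum.cong refl)
        fix F assume "F \<in> Pow E"
        then have F: "F \<subseteq> E" by simp
        have "(if F = E then 1 else inverse_KL (restriction ?M F)) = 1" using IH F by simp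
        then show "smult ((-1) ^ rk ?M F) (if F = E then 1 else inverse_KL (restriction ?M F)) *
          (\<Sum>G\<in>{G \<in> Pow E. F \<subseteq> G}. monom (mobius (Pow E) F G) (rk ?M G - rk ?M F)) =
          (-1) ^ card F * [:1, -1:] ^ (card E - card F)"
          unfolding inner[OF F] unfolding rk_free_matroid[OF less.prems F]
          by (cases "even (card F)") simp_all
      qed
      also have "\<dots> = (\<Sum>k\<le>card E. of_nat (card E choose k) * (-1) ^ k * [:1, -1:] ^ (card E - k))"
        unfolding sum_Pow_card[OF less.prems, of "\<lambda>k. (-1) ^ k * [:1, -1:] ^ (card E - k)"]
        by (simp only: mult.assoc)
      also have "\<dots> = [:0, -1:] ^ card E"
        unfolding binomial_ring[symmetric] by (simp add: one_pCons)
      also have "\<dots> = smult ((-1) ^ rank ?M) (rev_at (rank ?M) 1)"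
        unfolding r using rev_at_monom[of 0 "card E" 1]
        by (simp add: monom_power_eq[symmetric] smult_monom flip: one_pCons monom_eq_1)
      finally show "smult ((-1) ^ rank ?M) (rev_at (rank ?M) 1) =
        (\<Sum>F\<in>flats ?M. smult ((-1) ^ rk ?M F) (if F = ground ?M then 1 else inverse_KL (restriction ?M F)) *
          (\<Sum>G\<in>{G \<in> flats ?M. F \<subseteq> G}. monom (mobius (flats ?M) F G) (rk ?M G - rk ?M F)))" ..
    qed
  qed
qed

section \<open>The identity for \<open>thag S\<close> and the stated coefficients\<close>

lemma restriction_graphic_matroid:
  "F \<subseteq> E \<Longrightarrow> restriction (graphic_matroid E) F = graphic_matroid F"
  by (auto simp: restriction_def graphic_matroid_def)

lemma restriction_thag_partial_section:
  assumes "F \<in> partial_sections S"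
  shows "restriction (thag S) F = free_matroid F"
proof -
  have F: "F \<subseteq> thag_edges S" "hub \<notin> F" "doubles F = {}" using assms by (auto simp: partial_sections_def)
  have "indep (thag S) I" if "I \<subseteq> F" for I
  proof -
    have "doubles I = {}" using that F(3) unfolding doubles_def by blast
    then show ?thesis using that F unfolding indep_thag_iff by blast
  qed
  then show ?thesis by (auto simp: restriction_def free_matroid_def)
qed

text \<open>Proper flats containing \<open>hub\<close> are covered by induction on
  \<open>card S\<close>, partial sections by the Boolean case. What remains is
  \<open>rev_at_thagomizer_poly\<close> times the sign \<open>(-1) ^ Suc (card S)\<close>.\<close>

lemma inverse_KL_thag:
  assumes "finite S"
  shows "inverse_KL (thag S) = thagomizer_poly (card S)"
  using assms
proof (induction "card S" arbitrary: S rule: less_induct)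
  case less
  let ?M = "thag S" and ?n = "card S"
  note S = less.prems
  have r: "rank ?M = Suc ?n" using rk_thag_edges[OF S, of S] by simp
  let ?q = "\<lambda>F. if F = ground ?M then thagomizer_poly ?n else inverse_KL (restriction ?M F)"
  let ?c = "\<lambda>F. \<Sum>G\<in>{G \<in> flats ?M. F \<subseteq> G}. monom (mobius (flats ?M) F G) (rk ?M G - rk ?M F)"
  have q1: "?q (thag_edges A) = thagomizer_poly (card A)" if A: "A \<subseteq> S" for A
  proof (cases "A = S")
    case False
    have "restriction ?M (thag_edges A) = thag A"
      using A by (simp add: thag_def restriction_graphic_matroid)
    moreover have "card A < ?n" using A False S by (intro psubset_card_mono) auto
    moreover have "thag_edges A \<noteq> thag_edges S" using False by (metis ends_thag_edges)
    ultimately show ?thesis using less.hyps[of A] A S by (simp add: finite_subset)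
  qed simp
  have q2: "?q F = 1" if F: "F \<in> partial_sections S" for F
  proof -
    have "finite F" using F S by (auto simp: partial_sections_def intro: finite_subset[of _ "thag_edges S"])
    moreover have "F \<noteq> thag_edges S" using F by (auto simp: partial_sections_def)
    ultimately show ?thesis
      using inverse_KL_free_matroid restriction_thag_partial_section[OF F] by simp
  qed
  have split: "sum f (flats ?M) = (\<Sum>A\<in>Pow S. f (thag_edges A)) + sum f (partial_sections S)"
    for f :: "_ \<Rightarrow> int poly"
    using sum_flats_thag[OF S, where P = "\<lambda>F. True" and f = f] by (simp add: Pow_def)
  have sm: "smult ((-1) ^ k) p = (-1) ^ k * p" for k and p :: "int poly"
    by (cases "even k") simp_all
  show ?case
  proof (rule inverse_KL_eqI[OF matroid_thag[OF S]])
    show "0 < rank ?M" "2 * degree (thagomizer_poly ?n) < rank ?M"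
      using degree_thagomizer_poly[of ?n] r by simp_all
    have "(\<Sum>F\<in>flats ?M. smult ((-1) ^ rk ?M F) (?q F) * ?c F) =
        (\<Sum>A\<in>Pow S. smult ((-1) ^ rk ?M (thag_edges A)) (?q (thag_edges A)) * ?c (thag_edges A)) +
        (\<Sum>F\<in>partial_sections S. smult ((-1) ^ rk ?M F) (?q F) * ?c F)"
      by (rule split)
    also have "(\<Sum>A\<in>Pow S. smult ((-1) ^ rk ?M (thag_edges A)) (?q (thag_edges A)) * ?c (thag_edges A)) =
        (\<Sum>A\<in>Pow S. (-1) ^ Suc (card A) * thagomizer_poly (card A) * [:1, -1:] ^ (?n - card A))"
    proof (intro sum.cong refl)
      fix A assume "A \<in> Pow S"
      then have A: "A \<subseteq> S" by simp
      show "smult ((-1) ^ rk ?M (thag_edges A)) (?q (thag_edges A)) * ?c (thag_edges A) =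
          (-1) ^ Suc (card A) * thagomizer_poly (card A) * [:1, -1:] ^ (?n - card A)"
        unfolding q1[OF A] rev_char_poly_thag_edges[OF S A] unfolding rk_thag_edges[OF S A] sm ..
    qed
    also have "\<dots> = (\<Sum>k\<le>?n. of_nat (?n choose k) *
        ((-1) ^ Suc k * thagomizer_poly k * [:1, -1:] ^ (?n - k)))"
      by (rule sum_Pow_card[OF S])
    \<comment> \<open>The full sign exceeds \<open>(-1) ^ Suc k\<close> by \<open>?n - k\<close>
      factors, which turn \<open>1 - t\<close> into \<open>t - 1\<close>.\<close>
    also have "\<dots> = (-1) ^ Suc ?n * (\<Sum>k\<le>?n. of_nat (?n choose k) * [:-1, 1:] ^ (?n - k) * thagomizer_poly k)"
      unfolding sum_distrib_left
    proof (intro sum.cong refl)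
      fix k assume "k \<in> {..?n}"
      then have "(-1) ^ Suc ?n = (-1) ^ Suc k * (-1 :: int poly) ^ (?n - k)"
        by (simp flip: power_add)
      moreover have "(-1) ^ (?n - k) * [:-1, 1:] ^ (?n - k) = [:1, -1 :: int:] ^ (?n - k)"
        by (simp flip: power_mult_distrib)
      ultimately show "of_nat (?n choose k) * ((-1) ^ Suc k * thagomizer_poly k * [:1, -1:] ^ (?n - k)) =
          (-1) ^ Suc ?n * (of_nat (?n choose k) * [:-1, 1:] ^ (?n - k) * thagomizer_poly k)"
        by (simp only: mult_ac)
    qed
    also have "(\<Sum>F\<in>partial_sections S. smult ((-1) ^ rk ?M F) (?q F) * ?c F) =
        [:1, -1:] * (\<Sum>F\<in>partial_sections S. (-1) ^ card F * [:1, -2:] ^ (?n - card F))"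
      unfolding sum_distrib_left[of "[:1, -1:]"]
    proof (intro sum.cong refl)
      fix F assume F: "F \<in> partial_sections S"
      show "smult ((-1) ^ rk ?M F) (?q F) * ?c F = [:1, -1:] * ((-1) ^ card F * [:1, -2:] ^ (?n - card F))"
        unfolding q2[OF F] rev_char_poly_partial_section[OF S F] unfolding rk_partial_section[OF S F] sm mult_1_right
        by (simp only: mult_ac)
    qed
    \<comment> \<open>\<open>sum_partial_sections_power\<close> with \<open>x = -1\<close> and
      \<open>y = 1 - 2 t\<close>, so that \<open>2 x + y = - (1 + 2 t)\<close>.\<close>
    also have "(\<Sum>F\<in>partial_sections S. (-1) ^ card F * [:1, -2:] ^ (?n - card F)) = (-1) ^ ?n * [:1, 2 :: int:] ^ ?n"
      unfolding sum_partial_sections_power[OF S] power_mult_distrib[symmetric]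
      by (simp add: one_pCons numeral_poly)
    also have "(-1) ^ Suc ?n * (\<Sum>k\<le>?n. of_nat (?n choose k) * [:-1, 1:] ^ (?n - k) * thagomizer_poly k) +
        [:1, -1:] * ((-1) ^ ?n * [:1, 2:] ^ ?n) = (-1) ^ Suc ?n * rev_at (Suc ?n) (thagomizer_poly ?n)"
    proof -
      have "[:1, -1:] = - [:-1, 1 :: int:]" by simp
      then show ?thesis
        unfolding rev_at_thagomizer_poly by (simp only: power_Suc distrib_left mult_minus_left mult_1_left mult_ac minus_minus)
    qed
    finally show "smult ((-1) ^ rank ?M) (rev_at (rank ?M) (thagomizer_poly ?n)) =
        (\<Sum>F\<in>flats ?M. smult ((-1) ^ rk ?M F) (?q F) * ?c F)"
      unfolding r sm ..
  qed
qed

text \<open>The substitution \<open>(a, b, c) = (n - 2 i - j, i + j, i)\<close> in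
  \<open>KL_coeff_eq_sum_partitions3\<close>; the weight \<open>a - b + 1\<close> squares a hook
  factor. The limits of \<open>j\<close> say \<open>k \<le> b\<close> and \<open>b \<le> a\<close>.
  Since \<open>j\<close> is an integer, \<open>3 i > n\<close> makes the upper limit negative and
  the range empty.\<close>

lemma KL_coeff_eq:
  "of_int (KL_coeff n k) = (\<Sum>i = 0..k. \<Sum>j = int k - int i..(int n - 3 * int i) div 2.
     of_int ((j + 1) * (int n - 3 * int i - j + 2) * (int n - 3 * int i - 2 * j + 1)\<^sup>2) * fact n /
     (fact i * fact (nat (int i + j + 1)) * fact (nat (int n - 2 * int i - j + 2)) :: rat))"
proof -
  let ?t = "\<lambda>i j. of_int ((j + 1) * (int n - 3 * int i - j + 2) * (int n - 3 * int i - 2 * j + 1)\<^sup>2) * fact n /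
     (fact i * fact (nat (int i + j + 1)) * fact (nat (int n - 2 * int i - j + 2)) :: rat)"
  let ?D = "SIGMA i:{0..k}. {int k - int i..(int n - 3 * int i) div 2}"
  let ?P = "{(a, b, c) \<in> partitions3 n. c \<le> k \<and> k \<le> b}"
  have "of_int (KL_coeff n k) = (\<Sum>(a, b, c)\<in>?P. (of_nat a - of_nat b + 1) * num_SYT a b c)"
    unfolding KL_coeff_eq_sum_partitions3
    by (rule sum.mono_neutral_cong_right[OF finite_partitions3]) (auto simp: strip_count_def split: if_splits)
  also have "\<dots> = (\<Sum>(i, j)\<in>?D. ?t i j)"
  proof (rule sum.reindex_bij_witness[where j = "\<lambda>(a, b, c). (c, int b - int c)"
        and i = "\<lambda>(i, j). (nat (int n - 2 * int i - j), nat (int i + j), i)"])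
    fix x assume x: "x \<in> ?P"
    obtain a b c where abc: "x = (a, b, c)" by (cases x) auto
    have c: "c \<le> b" "b \<le> a" "n = a + b + c" "c \<le> k" "k \<le> b" using x abc by (auto simp: partitions3_def)
    show "(case case x of (a, b, c) \<Rightarrow> (c, int b - int c) of
        (i, j) \<Rightarrow> (nat (int n - 2 * int i - j), nat (int i + j), i)) = x"
      using c by (simp add: abc)
    show "(case x of (a, b, c) \<Rightarrow> (c, int b - int c)) \<in> ?D" using c by (simp add: abc)
    have e: "nat (int c + (int b - int c) + 1) = b + 1" "nat (int n - 2 * int c - (int b - int c) + 2) = a + 2"
      using c by auto
    show "(case case x of (a, b, c) \<Rightarrow> (c, int b - int c) of (i, j) \<Rightarrow> ?t i j) =
        (case x of (a, b, c) \<Rightarrow> (of_nat a - of_nat b + 1) * num_SYT a b c)"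
      unfolding abc prod.case e
      by (simp add: num_SYT_def c(3) power2_eq_square mult_ac del: fact_Suc) 
  next
    fix y assume "y \<in> ?D"
    then obtain i j where y: "y = (i, j)" "i \<le> k" "int k - int i \<le> j" "j \<le> (int n - 3 * int i) div 2"
      by auto
    \<comment> \<open>\<open>i \<le> k\<close> makes the lower limit nonnegative, so
      \<open>nat\<close> is applied only to nonnegative integers.\<close>
    have j: "0 \<le> j" "2 * j \<le> int n - 3 * int i" using y by linarith+
    show "(case case y of (i, j) \<Rightarrow> (nat (int n - 2 * int i - j), nat (int i + j), i) of
        (a, b, c) \<Rightarrow> (c, int b - int c)) = y" using j by (simp add: y)
    show "(case y of (i, j) \<Rightarrow> (nat (int n - 2 * int i - j), nat (int i + j), i)) \<in> ?P"
      using j y by (auto simp: partitions3_def)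
  qed
  also have "\<dots> = (\<Sum>i = 0..k. \<Sum>j = int k - int i..(int n - 3 * int i) div 2. ?t i j)"
    by (rule sum.Sigma[symmetric]) auto
  finally show ?thesis .
qed

theorem theorem3p4:
  fixes n :: nat
  shows "map_poly rat_of_int (inverse_KL (thagomizer n)) =
    (\<Sum>k = 0..n div 2. monom
       (\<Sum>i = 0..k. \<Sum>j = int k - int i..(int n - 3 * int i) div 2.
          of_int ((j + 1) * (int n - 3 * int i - j + 2) * (int n - 3 * int i - 2 * j + 1)\<^sup>2) * fact n /
          (fact i * fact (nat (int i + j + 1)) * fact (nat (int n - 2 * int i - j + 2)))) k)"
proof -
  have "inverse_KL (thagomizer n) = thagomizer_poly n"
    using inverse_KL_thag[of "{1..n}"] by (simp add: thagomizer_def K11_edges_eq thag_def)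
  moreover have "map_poly rat_of_int (thagomizer_poly n) =
      (\<Sum>k = 0..n div 2. monom (of_int (KL_coeff n k)) k)"
  proof (rule poly_eqI)
    fix m
    \<comment> \<open>Beyond \<open>n div 2\<close> the range \<open>2 * m..n\<close> is
      empty.\<close>
    have "KL_coeff n m = 0" if "\<not> m \<le> n div 2" using that by (auto simp: KL_coeff_def)
    then show "coeff (map_poly rat_of_int (thagomizer_poly n)) m =
        coeff (\<Sum>k = 0..n div 2. monom (rat_of_int (KL_coeff n k)) k) m"
      by (auto simp: coeff_map_poly coeff_thagomizer_poly coeff_sum)
  qed
  ultimately show ?thesis by (simp only: KL_coeff_eq)
qed

end
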